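(* Let $0<\alpha<1$, $\beta>1$, $L>0$, $k>0$, $\bar d>0$, and let $G$ be an undirected and connected graph with $N$ nodes and adjacency matrix $A=(a_{ij})$. Consider the multi-agent system, for $x\in[0,L]$, $t\ge 0$, $i=1,\dots,N$, $$y_{i,t}(x,t)=k\,y_{i,xx}(x,t)+u_i(x,t)+d_i(x,t),\qquad y_i(0,t)=y_i(L,t)=0,\qquad y_i(x,0)=y_i^0(x),$$ where each $y_i^0$ is bounded and continuous on $[0,L]$, each disturbance $d_i$ is continuous in $x$ and $t$ and satisfies $|d_i(x,t)|\le d_{\max}$ for all $x\in[0,L]$, $t\in[0,\infty)$, with $d_{\max}$ a known constant. With $\xi_{ij}(x,t)=y_i(x,t)-y_j(x,t)$, let the controller be $$u_i(x,t)=-\sum_{j=1}^{N}a_{ij}\left(\int_0^L\xi_{ij}(x,t)^{2}\,\mathrm{d}x\right)^{\alpha-1}\xi_{ij}(x,t)-\sum_{j=1}^{N}a_{ij}\left(\int_0^L\xi_{ij}(x,t)^{2}\,\mathrm{d}x\right)^{\beta-1}\xi_{ij}(x,t)-\bar d\sum_{j=1}^{N}a_{ij}\,\mathrm{sign}(\xi_{ij}(x,t)).$$ Let $E=(a_{ij}^2)$, $B=(a_{ij}^{1/\alpha})$ and $P=(a_{ij}^{1/\beta})$ in $\mathbb{R}^{N\times N}$. If $$\bar d\ge\frac{2d_{\max}N^{1/2}}{\sqrt2\,\lambda_2(\mathcal{L}(E))^{1/2}},$$ then the system achieves fixed-time consensus, and the finite terminal time $t^*$ satisfies $$t^*\le T_{\max}:=\frac{1}{C_1(1-\alpha)}+\frac{1}{(N^{1-\beta})^2C_2(\beta-1)},$$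 where $C_1=\left(2\lambda_2(\mathcal{L}(B))\right)^{\alpha}$ and $C_2=\left(2\lambda_2(\mathcal{L}(P))\right)^{\beta}$.
   Context: Graph: $G=\{\mathfrak V,\mathfrak E,A\}$ has vertices $v_1,\dots,v_N$ and nonnegative adjacency matrix $A=(a_{ij})$, with $a_{ij}>0$ if node $v_i$ can receive data from $v_j$ (i.e. $(v_j,v_i)\in\mathfrak E$, $v_j\in N_i$), and $a_{ij}=0$ otherwise. Undirected means $a_{ij}=a_{ji}$. An undirected graph is connected if for any pair $v_i,v_j$ there is a sequence $a_{ii_1},a_{i_1i_2},\dots,a_{i_mj}$ all of whose elements are positive. Laplacian: for a nonnegative matrix $M=(m_{ij})$ viewed as an adjacency matrix, $\mathcal L(M)=(l_{ij})$ with $l_{ij}=-m_{ij}$ for $j\neq i$ and $l_{ii}=\sum_{j\ne i}m_{ij}$. For symmetric $\mathcal L(M)$, $\lambda_2(\mathcal L(M))=\min_{x\ne0,\ \langle x,\mathbf 1\rangle=0}\frac{\langle x,\mathcal L(M)x\rangle}{\langle x,x\rangle}$, the second smallest eigenvalue, where $\mathbf 1=[1,\dots,1]^T$. Finite-time consensus (FTC): there exists a finite time $t^*$ (the terminal time) such that $\lim_{t\to t^*}|y_i(x,t)-y_j(x,t)|=0$ for any $x\in[0,L]$ and $i,j=1,\dots,N$. Fixed-time consensus (FXC): FTC holds and in addition the terminal time $t^*$ is bounded by a positive constant $T_{\max}$ independent of the initial condition. Subscripts $t$, $xx$ denote partial derivatives. The term $\left(\int_0^L\xi_{ij}^2\,\mathrm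 dx\right)^{\alpha-1}\xi_{ij}$ is read as $0$ when $\xi_{ij}(\cdot,t)\equiv0$ (in particular for $i=j$). *)

theory Defs
  imports "HOL-Analysis.Analysis"
begin

text \<open>Graphs on the finite vertex type \<open>'n\<close> are given by their adjacency matrices: there is an
  edge from \<open>j\<close> to \<open>i\<close> iff \<open>A $ i $ j > 0\<close>.\<close>

definition adjacency_matrix :: "real ^ 'n ^ 'n \<Rightarrow> bool" where
  "adjacency_matrix A \<longleftrightarrow> (\<forall>i j. A $ i $ j \<ge> 0)"

definition undirected :: "real ^ 'n ^ 'n \<Rightarrow> bool" where
  "undirected A \<longleftrightarrow> (\<forall>i j. A $ i $ j = A $ j $ i)"

definition connected_graph :: "real ^ 'n ^ 'n \<Rightarrow> bool" where
  "connected_graph A \<longleftrightarrow> (\<forall>i j. i \<noteq> j \<longrightarrow> (i, j) \<in> {(p, q). A $ p $ q > 0}\<^sup>+)"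

definition laplacian :: "real ^ 'n ^ 'n \<Rightarrow> real ^ 'n ^ 'n" where
  "laplacian M = (\<chi> i j. if i = j then (\<Sum>l\<in>UNIV - {i}. M $ i $ l) else - M $ i $ j)"

text \<open>For a symmetric \<open>M\<close> and at least two vertices the infimum is attained, so it is the minimum of
  the Rayleigh quotient. With a single vertex there is no admissible \<open>x\<close> and the value carries no
  meaning.\<close>

definition lambda2 :: "real ^ 'n ^ 'n \<Rightarrow> real" where
  "lambda2 M = Inf {(x \<bullet> (M *v x)) / (x \<bullet> x) | x. x \<noteq> 0 \<and> x \<bullet> (\<chi> i. 1) = 0}"

text \<open>The sign as a set-valued map, i.e. the Filippov regularisation of \<open>sgn\<close>. The closed loop has a
  discontinuous right-hand side, and a trajectory that stays in consensus under nonidentical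
  disturbances exists only in this sense.\<close>

definition sign_set :: "real \<Rightarrow> real set" where
  "sign_set r = (if r = 0 then {-1..1} else {sgn r})"

text \<open>Since the sign is odd, the regularised signs of \<open>y\<^sub>i - y\<^sub>j\<close> and \<open>y\<^sub>j - y\<^sub>i\<close> are opposite.\<close>

definition admissible_signs :: "('n \<Rightarrow> real) \<Rightarrow> ('n \<Rightarrow> 'n \<Rightarrow> real) \<Rightarrow> bool" where
  "admissible_signs v \<sigma> \<longleftrightarrow>
     (\<forall>i j. \<sigma> i j \<in> sign_set (v i - v j)) \<and> (\<forall>i j. \<sigma> j i = - \<sigma> i j)"

text \<open>States are written \<open>y i x t\<close> for agent \<open>i\<close>, position \<open>x\<close> and time \<open>t\<close>. The argument \<open>\<sigma> i j\<close>
  stands for the sign of \<open>y i x t - y j x t\<close>. As \<open>0 powr a = 0\<close>, the nonlinear terms are \<open>0\<close> where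
  two agents coincide on all of \<open>[0,L]\<close>.\<close>

definition control ::
  "real ^ 'n ^ 'n \<Rightarrow> real \<Rightarrow> real \<Rightarrow> real \<Rightarrow> real \<Rightarrow> ('n \<Rightarrow> real \<Rightarrow> real \<Rightarrow> real) \<Rightarrow>
     ('n \<Rightarrow> 'n \<Rightarrow> real) \<Rightarrow> 'n \<Rightarrow> real \<Rightarrow> real \<Rightarrow> real" where
  "control A L \<alpha> \<beta> dbar y \<sigma> i x t =
     - (\<Sum>j\<in>UNIV. A $ i $ j *
          (integral {0..L} (\<lambda>z. (y i z t - y j z t)\<^sup>2)) powr (\<alpha> - 1) * (y i x t - y j x t))
     - (\<Sum>j\<in>UNIV. A $ i $ j *
          (integral {0..L} (\<lambda>z. (y i z t - y j z t)\<^sup>2)) powr (\<beta> - 1) * (y i x t - y j x t))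
     - dbar * (\<Sum>j\<in>UNIV. A $ i $ j * \<sigma> i j)"

text \<open>For an interval \<open>S\<close>: \<open>f\<close> is locally absolutely continuous on \<open>S\<close>, and \<open>f'\<close> is its derivative
  almost everywhere.\<close>

definition ac_derivative_on :: "(real \<Rightarrow> real) \<Rightarrow> (real \<Rightarrow> real) \<Rightarrow> real set \<Rightarrow> bool" where
  "ac_derivative_on f f' S \<longleftrightarrow>
     (\<forall>a\<in>S. \<forall>b\<in>S. a \<le> b \<longrightarrow>
        f' absolutely_integrable_on {a..b} \<and> integral {a..b} f' = f b - f a)"

definition locally_square_integrable :: "real \<Rightarrow> (real \<Rightarrow> real \<Rightarrow> real) \<Rightarrow> bool" where
  "locally_square_integrable L g \<longleftrightarrow>
     (\<lambda>(x, t). g x t) \<in> borel_measurable borel \<and>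
     (\<forall>a b. 0 < a \<and> a \<le> b \<longrightarrow>
        set_integrable lborel ({0..L} \<times> {a..b}) (\<lambda>(x, t). (g x t)\<^sup>2))"

text \<open>Regularity of a strong solution on \<open>[0,L] \<times> (0,\<infinity>)\<close>: \<open>w\<close> is continuous, and its partial
  derivatives \<open>wt\<close> and \<open>wxx\<close> exist almost everywhere and are square integrable away from \<open>t = 0\<close>.
  The derivatives \<open>wt\<close>, \<open>wxx\<close> cannot be required to be continuous since the right-hand side of the
  closed loop jumps where two states cross.\<close>

definition strong_derivatives ::
  "real \<Rightarrow> (real \<Rightarrow> real \<Rightarrow> real) \<Rightarrow> (real \<Rightarrow> real \<Rightarrow> real) \<Rightarrow> (real \<Rightarrow> real \<Rightarrow> real) \<Rightarrow> bool" where
  "strong_derivatives L w wt wxx \<longleftrightarrow>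
     continuous_on ({0..L} \<times> {0<..}) (\<lambda>(x, t). w x t) \<and>
     locally_square_integrable L wt \<and> locally_square_integrable L wxx \<and>
     (AE x in lborel. x \<in> {0..L} \<longrightarrow> ac_derivative_on (w x) (wt x) {0<..}) \<and>
     (AE t in lborel. t > 0 \<longrightarrow>
        (\<exists>wx. ac_derivative_on (\<lambda>x. w x t) wx {0..L} \<and>
              ac_derivative_on wx (\<lambda>x. wxx x t) {0..L}))"

text \<open>The boundary condition is imposed for \<open>t > 0\<close> and the initial value is attained in
  \<open>L\<^sup>2(0,L)\<close>, so that \<open>y0\<close> need not vanish at \<open>0\<close> and \<open>L\<close>.\<close>

definition closed_loop_solution ::
  "real ^ 'n ^ 'n \<Rightarrow> real \<Rightarrow> real \<Rightarrow> real \<Rightarrow> real \<Rightarrow> real \<Rightarrow> ('n \<Rightarrow> real \<Rightarrow> real \<Rightarrow> real) \<Rightarrow>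
     ('n \<Rightarrow> real \<Rightarrow> real) \<Rightarrow> ('n \<Rightarrow> real \<Rightarrow> real \<Rightarrow> real) \<Rightarrow> bool" where
  "closed_loop_solution A L k \<alpha> \<beta> dbar d y0 y \<longleftrightarrow>
     (\<exists>yt yxx.
        (\<forall>i. strong_derivatives L (y i) (yt i) (yxx i)) \<and>
        (AE (x, t) in lborel. x \<in> {0..L} \<and> t > 0 \<longrightarrow>
           (\<exists>\<sigma>. admissible_signs (\<lambda>i. y i x t) \<sigma> \<and>
                (\<forall>i. yt i x t = k * yxx i x t + control A L \<alpha> \<beta> dbar y \<sigma> i x t + d i x t)))) \<and>
     (\<forall>i. \<forall>t>0. y i 0 t = 0 \<and> y i L t = 0) \<and>
     (\<forall>i. \<forall>x\<in>{0..L}. y i x 0 = y0 i x) \<and>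
     (\<forall>i. ((\<lambda>t. integral {0..L} (\<lambda>x. (y i x t - y0 i x)\<^sup>2)) \<longlongrightarrow> 0) (at_right 0))"

definition closed_loop_trajectories ::
  "real ^ 'n ^ 'n \<Rightarrow> real \<Rightarrow> real \<Rightarrow> real \<Rightarrow> real \<Rightarrow> real \<Rightarrow> ('n \<Rightarrow> real \<Rightarrow> real \<Rightarrow> real) \<Rightarrow>
     ('n \<Rightarrow> real \<Rightarrow> real \<Rightarrow> real) set" where
  "closed_loop_trajectories A L k \<alpha> \<beta> dbar d =
     {y. \<exists>y0. (\<forall>i. continuous_on {0..L} (y0 i) \<and> bounded (y0 i ` {0..L})) \<and>
              closed_loop_solution A L k \<alpha> \<beta> dbar d y0 y}"

definition terminal_time :: "real \<Rightarrow> ('n \<Rightarrow> real \<Rightarrow> real \<Rightarrow> real) \<Rightarrow> real \<Rightarrow> bool" where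
  "terminal_time L y ts \<longleftrightarrow> ts \<ge> 0 \<and>
     (\<forall>x\<in>{0..L}. \<forall>i j. ((\<lambda>t. \<bar>y i x t - y j x t\<bar>) \<longlongrightarrow> 0) (at ts within {0..}))"

definition finite_time_consensus ::
  "real \<Rightarrow> ('n \<Rightarrow> real \<Rightarrow> real \<Rightarrow> real) set \<Rightarrow> bool" where
  "finite_time_consensus L Y \<longleftrightarrow> (\<forall>y\<in>Y. \<exists>ts. terminal_time L y ts)"

definition fixed_time_consensus ::
  "real \<Rightarrow> ('n \<Rightarrow> real \<Rightarrow> real \<Rightarrow> real) set \<Rightarrow> bool" where
  "fixed_time_consensus L Y \<longleftrightarrow> finite_time_consensus L Y \<and>
     (\<exists>Tmax>0. \<forall>y\<in>Y. \<exists>ts. terminal_time L y ts \<and> ts \<le> Tmax)"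

text \<open>Trajectories with the sign taken literally (\<open>sgn 0 = 0\<close>) and with partial derivatives that
  exist everywhere and are locally bounded for \<open>t > 0\<close> are covered by \<open>closed_loop_trajectories\<close>.\<close>

lemma ac_derivative_on_bounded:
  fixes f f' :: "real \<Rightarrow> real"
  assumes S: "is_interval S"
    and der: "\<And>x. x \<in> S \<Longrightarrow> (f has_real_derivative f' x) (at x within S)"
    and bnd: "\<And>a b. a \<in> S \<Longrightarrow> b \<in> S \<Longrightarrow> bounded (f' ` {a..b})"
  shows "ac_derivative_on f f' S"
  unfolding ac_derivative_on_def
proof (intro ballI impI)
  fix a b assume ab: "a \<in> S" "b \<in> S" "a \<le> b"
  have sub: "{a..b} \<subseteq> S"
    using ab S by (meson atLeastAtMost_iff mem_is_interval_1_I subsetI)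
  have int: "(f' has_integral (f b - f a)) {a..b}"
  proof (rule fundamental_theorem_of_calculus[OF ab(3)])
    fix x assume "x \<in> {a..b}"
    thus "(f has_vector_derivative f' x) (at x within {a..b})"
      using DERIV_subset[OF der sub] sub
      by (auto simp: has_real_derivative_iff_has_vector_derivative)
  qed
  obtain K where K: "\<And>x. x \<in> {a..b} \<Longrightarrow> norm (f' x) \<le> K"
    using bnd[OF ab(1,2)] unfolding bounded_iff by blast
  have "f' absolutely_integrable_on {a..b}"
    using K has_integral_integrable[OF int] integrable_const_ivl
    by (rule absolutely_integrable_integrable_bound)
  thus "f' absolutely_integrable_on {a..b} \<and> integral {a..b} f' = f b - f a"
    using int by (simp add: integral_unique)
qed

lemma ac_derivative_on_cong:
  assumes "is_interval S" "\<And>x. x \<in> S \<Longrightarrow> f' x = g' x"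
  shows "ac_derivative_on f f' S \<longleftrightarrow> ac_derivative_on f g' S"
proof -
  have "f' absolutely_integrable_on {a..b} \<longleftrightarrow> g' absolutely_integrable_on {a..b}"
       "integral {a..b} f' = integral {a..b} g'" if "a \<in> S" "b \<in> S" for a b
  proof -
    have sub: "{a..b} \<subseteq> S"
      using that assms(1) by (meson atLeastAtMost_iff mem_is_interval_1_I subsetI)
    show "f' absolutely_integrable_on {a..b} \<longleftrightarrow> g' absolutely_integrable_on {a..b}"
      using sub assms(2) by (intro set_integrable_cong) auto
    show "integral {a..b} f' = integral {a..b} g'"
      using sub assms(2) by (intro Henstock_Kurzweil_Integration.integral_cong) auto
  qed
  thus ?thesis by (simp add: ac_derivative_on_def)
qed

lemma locally_square_integrable_bounded:
  assumes meas: "set_borel_measurable borel ({0..L} \<times> {0<..}) (\<lambda>(x, t). g x t)"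
    and bnd: "\<And>a b. 0 < a \<Longrightarrow> a \<le> b \<Longrightarrow> bounded ((\<lambda>(x, t). g x t) ` ({0..L} \<times> {a..b}))"
  shows "locally_square_integrable L (\<lambda>x t. indicator ({0..L} \<times> {0<..}) (x, t) * g x t)"
  unfolding locally_square_integrable_def
proof (intro conjI allI impI)
  let ?R = "{0..L} \<times> {0::real<..}"
  let ?h = "\<lambda>(x, t). indicator ?R (x, t) * g x t"
  have eq: "?h = (\<lambda>p. indicator ?R p *\<^sub>R (case p of (x, t) \<Rightarrow> g x t))"
    by auto
  show hm: "?h \<in> borel_measurable borel"
    using meas unfolding eq set_borel_measurable_def .
  hence hm': "?h \<in> borel_measurable lborel"
    by (simp only: measurable_lborel2)
  fix a b :: real assume ab: "0 < a \<and> a \<le> b"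
  obtain K where K: "\<And>x t. x \<in> {0..L} \<Longrightarrow> t \<in> {a..b} \<Longrightarrow> \<bar>g x t\<bar> \<le> K"
    using bnd[of a b] ab unfolding bounded_iff by fastforce
  have box: "{0..L} \<times> {a..b} = cbox (0, a) (L, b)"
    by (auto simp: cbox_Pair_eq)
  have "set_integrable lborel ({0..L} \<times> {a..b}) (\<lambda>p. (?h p)\<^sup>2)"
    unfolding set_integrable_def
  proof (rule Bochner_Integration.integrable_bound)
    show "integrable lborel (\<lambda>p. indicator ({0..L} \<times> {a..b}) p *\<^sub>R K\<^sup>2)"
      unfolding box
      by (intro integrable_scaleR_left integrable_real_indicator emeasure_lborel_cbox_finite) auto
    show "(\<lambda>p. indicator ({0..L} \<times> {a..b}) p *\<^sub>R (?h p)\<^sup>2) \<in> borel_measurable lborel"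
      by (rule borel_measurable_scaleR[OF borel_measurable_indicator borel_measurable_power[OF hm']])
         (unfold box, simp)
    have "(g x t)\<^sup>2 \<le> K\<^sup>2" if "x \<in> {0..L}" "t \<in> {a..b}" for x t
      using K[OF that] by (metis abs_ge_zero power2_abs power_mono)
    thus "AE p in lborel. norm (indicator ({0..L} \<times> {a..b}) p *\<^sub>R (?h p)\<^sup>2)
           \<le> norm (indicator ({0..L} \<times> {a..b}) p *\<^sub>R K\<^sup>2)"
      by (intro AE_I2) (auto simp: indicator_def)
  qed
  thus "set_integrable lborel ({0..L} \<times> {a..b})
          (\<lambda>(x, t). (indicator ?R (x, t) * g x t)\<^sup>2)"
    by (simp add: case_prod_beta')
qed

lemma literal_sign_solution_in_closed_loop_trajectories:
  fixes y yt yx yxx d :: "'n::finite \<Rightarrow> real \<Rightarrow> real \<Rightarrow> real"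
  assumes L: "L > 0"
    and cont: "\<And>i. continuous_on ({0..L} \<times> {0..}) (\<lambda>(x, t). y i x t)"
    and dt: "\<And>i x t. x \<in> {0..L} \<Longrightarrow> t > 0 \<Longrightarrow> (y i x has_real_derivative yt i x t) (at t)"
    and dx: "\<And>i x t. x \<in> {0..L} \<Longrightarrow> t > 0 \<Longrightarrow>
      ((\<lambda>z. y i z t) has_real_derivative yx i x t) (at x within {0..L})"
    and dxx: "\<And>i x t. x \<in> {0..L} \<Longrightarrow> t > 0 \<Longrightarrow>
      ((\<lambda>z. yx i z t) has_real_derivative yxx i x t) (at x within {0..L})"
    and meas: "\<And>i. set_borel_measurable borel ({0..L} \<times> {0<..}) (\<lambda>(x, t). yt i x t)"
              "\<And>i. set_borel_measurable borel ({0..L} \<times> {0<..}) (\<lambda>(x, t). yxx i x t)"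
    and bnd: "\<And>i a b. 0 < a \<Longrightarrow> a \<le> b \<Longrightarrow> bounded ((\<lambda>(x, t). yt i x t) ` ({0..L} \<times> {a..b}))"
             "\<And>i a b. 0 < a \<Longrightarrow> a \<le> b \<Longrightarrow> bounded ((\<lambda>(x, t). yxx i x t) ` ({0..L} \<times> {a..b}))"
    and pde: "\<And>i x t. x \<in> {0..L} \<Longrightarrow> t > 0 \<Longrightarrow> yt i x t = k * yxx i x t
      + control A L \<alpha> \<beta> dbar y (\<lambda>i j. sgn (y i x t - y j x t)) i x t + d i x t"
    and bc: "\<And>i t. t \<ge> 0 \<Longrightarrow> y i 0 t = 0 \<and> y i L t = 0"
  shows "y \<in> closed_loop_trajectories A L k \<alpha> \<beta> dbar d"
proof -
  let ?R = "{0..L} \<times> {0::real<..}"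
  let ?yt = "\<lambda>i x t. indicator ?R (x, t) * yt i x t"
  let ?yxx = "\<lambda>i x t. indicator ?R (x, t) * yxx i x t"
  have sd: "strong_derivatives L (y i) (?yt i) (?yxx i)" for i
    unfolding strong_derivatives_def
  proof (intro conjI AE_I2 impI)
    show "continuous_on ?R (\<lambda>(x, t). y i x t)"
      by (rule continuous_on_subset[OF cont]) auto
    show "locally_square_integrable L (?yt i)" "locally_square_integrable L (?yxx i)"
      using meas bnd by (auto intro!: locally_square_integrable_bounded)
  next
    fix x assume x: "x \<in> {0..L}"
    have "ac_derivative_on (y i x) (yt i x) {0<..}"
    proof (rule ac_derivative_on_bounded)
      fix a b :: real assume "a \<in> {0<..}" "b \<in> {0<..}"
      show "bounded (yt i x ` {a..b})"
      proof (cases "a \<le> b")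
        case True
        have "yt i x ` {a..b} \<subseteq> (\<lambda>(x, t). yt i x t) ` ({0..L} \<times> {a..b})"
          using x by auto
        thus ?thesis using bnd(1)[of a b i] True \<open>a \<in> {0<..}\<close> bounded_subset by auto
      qed auto
    qed (use x dt in \<open>auto intro: has_field_derivative_at_within simp: is_interval_1\<close>)
    thus "ac_derivative_on (y i x) (?yt i x) {0<..}"
      using x by (subst ac_derivative_on_cong[where g' = "yt i x"]) (auto simp: is_interval_1)
  next
    fix t :: real assume t: "t > 0"
    have yxxb: "bounded ((\<lambda>x. yxx i x t) ` {a..b})" if "a \<in> {0..L}" "b \<in> {0..L}" for a b
    proof -
      have "(\<lambda>x. yxx i x t) ` {a..b} \<subseteq> (\<lambda>(x, t). yxx i x t) ` ({0..L} \<times> {t..t})"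
        using that by auto
      thus ?thesis using bnd(2)[of t t i] t bounded_subset by auto
    qed
    have "ac_derivative_on (\<lambda>x. yx i x t) (\<lambda>x. yxx i x t) {0..L}"
      using t dxx yxxb by (intro ac_derivative_on_bounded) (auto simp: is_interval_1)
    hence 1: "ac_derivative_on (\<lambda>x. yx i x t) (\<lambda>x. ?yxx i x t) {0..L}"
      using t by (subst ac_derivative_on_cong[where g' = "\<lambda>x. yxx i x t"])
        (auto simp: is_interval_1)
    have "continuous_on {0..L} (\<lambda>x. yx i x t)"
      using dxx t by (meson DERIV_continuous_on)
    hence yxb: "bounded ((\<lambda>x. yx i x t) ` {a..b})" if "a \<in> {0..L}" "b \<in> {0..L}" for a b
      using that
      by (intro compact_imp_bounded compact_continuous_image)
         (auto intro: continuous_on_subset)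
    have 2: "ac_derivative_on (\<lambda>x. y i x t) (\<lambda>x. yx i x t) {0..L}"
      using t dx yxb by (intro ac_derivative_on_bounded) (auto simp: is_interval_1)
    show "\<exists>wx. ac_derivative_on (\<lambda>x. y i x t) wx {0..L} \<and>
              ac_derivative_on wx (\<lambda>x. ?yxx i x t) {0..L}"
      using 1 2 by blast
  qed
  have init: "((\<lambda>t. integral {0..L} (\<lambda>x. (y i x t - y i x 0)\<^sup>2)) \<longlongrightarrow> 0) (at_right 0)" for i
  proof -
    have c: "continuous_on ({0..} \<times> {0..L}) (\<lambda>(t, x). (y i x t - y i x 0)\<^sup>2)"
    proof -
      have "continuous_on ({0..} \<times> {0..L}) (\<lambda>p. y i (snd p) (fst p))"
        by (rule continuous_on_compose2[OF cont[of i], of _ "\<lambda>p. (snd p, fst p)", simplified])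
           (auto intro!: continuous_on_Pair continuous_on_fst[OF continuous_on_id]
              continuous_on_snd[OF continuous_on_id])
      moreover have "continuous_on ({0::real..} \<times> {0..L}) (\<lambda>p. y i (snd p) 0)"
        by (rule continuous_on_compose2[OF cont[of i], of _ "\<lambda>p. (snd p, 0)", simplified])
           (auto intro!: continuous_on_Pair continuous_on_const continuous_on_snd[OF continuous_on_id])
      ultimately show ?thesis
        unfolding case_prod_beta' by (intro continuous_on_power continuous_on_diff)
    qed
    have "continuous_on {0..} (\<lambda>t. integral (cbox 0 L) (\<lambda>x. (y i x t - y i x 0)\<^sup>2))"
      by (rule integral_continuous_on_param) (use c in auto)
    from this[unfolded continuous_on_def, rule_format, of 0]
    have "((\<lambda>t. integral {0..L} (\<lambda>x. (y i x t - y i x 0)\<^sup>2)) \<longlongrightarrow> 0) (at 0 within {0..})"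
      by simp
    thus ?thesis by (rule tendsto_within_subset) auto
  qed
  have y0: "continuous_on {0..L} (\<lambda>x. y i x 0)" for i
    by (rule continuous_on_compose2[OF cont[of i], of _ "\<lambda>x. (x, 0)", simplified])
       (auto intro!: continuous_on_Pair continuous_on_const continuous_on_id)
  hence y0b: "bounded ((\<lambda>x. y i x 0) ` {0..L})" for i
    by (intro compact_imp_bounded compact_continuous_image) auto
  have adm: "admissible_signs (\<lambda>i. y i x t) (\<lambda>i j. sgn (y i x t - y j x t))" for x t
    by (auto simp: admissible_signs_def sign_set_def sgn_if)
  have eq: "AE (x, t) in lborel. x \<in> {0..L} \<and> t > 0 \<longrightarrow>
         (\<exists>\<sigma>. admissible_signs (\<lambda>i. y i x t) \<sigma> \<and>
              (\<forall>i. ?yt i x t = k * ?yxx i x t + control A L \<alpha> \<beta> dbar y \<sigma> i x t + d i x t))"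
  proof (intro AE_I2, clarify, goal_cases)
    case (1 x t)
    thus ?case using adm pde by (intro exI[of _ "\<lambda>i j. sgn (y i x t - y j x t)"]) auto
  qed
  have "closed_loop_solution A L k \<alpha> \<beta> dbar d (\<lambda>i x. y i x 0) y"
    unfolding closed_loop_solution_def
    by (intro conjI, rule exI[of _ ?yt], rule exI[of _ ?yxx], intro conjI allI sd eq)
       (use bc init in auto)
  thus ?thesis
    unfolding closed_loop_trajectories_def using y0 y0b
    by (intro CollectI exI[of _ "\<lambda>i x. y i x 0"]) auto
qed

end

theory Submission
  imports Defs
begin

text \<open>The Lyapunov function is \<open>W t = \<Sum>\<^sub>i \<integral>\<^sub>0\<^sup>L e\<^sub>i(x,t)\<^sup>2 dx\<close>, where \<open>e\<^sub>i = y\<^sub>i - (\<Sum>\<^sub>j y\<^sub>j) / N\<close>. Along a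
  trajectory the diffusion contributes \<open>- 2 k \<Sum>\<^sub>i \<integral> (\<partial>\<^sub>x e\<^sub>i)\<^sup>2 \<le> 0\<close>, and the sign term dominates the
  disturbance because \<open>\<Sum>\<^sub>i\<^sub>j a\<^sub>i\<^sub>j \<bar>\<xi>\<^sub>i\<^sub>j\<bar> \<ge> (\<Sum>\<^sub>i\<^sub>j a\<^sub>i\<^sub>j\<^sup>2 \<xi>\<^sub>i\<^sub>j\<^sup>2)\<^sup>1\<^sup>/\<^sup>2 \<ge> (2 \<lambda>\<^sub>2(E) \<Sum>\<^sub>i e\<^sub>i\<^sup>2)\<^sup>1\<^sup>/\<^sup>2\<close>. With
  \<open>w\<^sub>i\<^sub>j = \<integral> \<xi>\<^sub>i\<^sub>j\<^sup>2\<close> what remains is \<open>W' \<le> - \<Sum>\<^sub>i\<^sub>j a\<^sub>i\<^sub>j (w\<^sub>i\<^sub>j\<^sup>\<alpha> + w\<^sub>i\<^sub>j\<^sup>\<beta>)\<close>, and subadditivity of the power \<open>\<alpha>\<close>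
  and the power mean inequality for \<open>\<beta>\<close> turn this into \<open>W' \<le> - C\<^sub>1 W\<^sup>\<alpha> - (N\<^sup>1\<^sup>-\<^sup>\<beta>)\<^sup>2 C\<^sub>2 W\<^sup>\<beta>\<close>. The
  second term brings \<open>W\<close> below \<open>1\<close> from any value, and the first one then brings it to \<open>0\<close>; the
  two durations add up to \<open>T\<^sub>m\<^sub>a\<^sub>x\<close>. As the trajectories have only weak derivatives, the differential
  inequality is used in integrated form throughout.\<close>

section \<open>Algebraic connectivity\<close>

lemma laplacian_mult:
  fixes x :: "real ^ 'n"
  shows "(laplacian M *v x) $ i = (\<Sum>j\<in>UNIV. M $ i $ j * (x $ i - x $ j))"
proof -
  have "(laplacian M *v x) $ i = (\<Sum>j\<in>UNIV. laplacian M $ i $ j * x $ j)"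
    by (simp add: matrix_vector_mult_def)
  also have "\<dots> = laplacian M $ i $ i * x $ i + (\<Sum>j\<in>UNIV - {i}. laplacian M $ i $ j * x $ j)"
    by (rule sum.remove) auto
  also have "\<dots> = (\<Sum>j\<in>UNIV - {i}. M $ i $ j * (x $ i - x $ j))"
    by (simp add: laplacian_def sum_distrib_right sum_subtractf right_diff_distrib flip: sum_negf)
  also have "\<dots> = (\<Sum>j\<in>UNIV. M $ i $ j * (x $ i - x $ j))"
    by (subst (2) sum.remove[of _ i]) auto
  finally show ?thesis .
qed

text \<open>Summation by parts: renaming the two indices turns half of the left side into a sum
  against \<open>- x j\<close>. It serves the quadratic form of the Laplacian as well as the
  couplings of the controller.\<close>

lemma sum_antisymmetric_mult:
  fixes c :: "'n::finite \<Rightarrow> 'n \<Rightarrow> real"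
  assumes "\<And>i j. c j i = - c i j"
  shows "2 * (\<Sum>i\<in>UNIV. x i * (\<Sum>j\<in>UNIV. c i j)) = (\<Sum>i\<in>UNIV. \<Sum>j\<in>UNIV. c i j * (x i - x j))"
proof -
  have 1: "(\<Sum>i\<in>UNIV. x i * (\<Sum>j\<in>UNIV. c i j)) = (\<Sum>i\<in>UNIV. \<Sum>j\<in>UNIV. c i j * x i)"
    by (simp add: sum_distrib_left mult.commute)
  have "(\<Sum>i\<in>UNIV. \<Sum>j\<in>UNIV. c i j * x i) = (\<Sum>i\<in>UNIV. \<Sum>j\<in>UNIV. c j i * x j)"
    by (rule sum.swap)
  also have "\<dots> = - (\<Sum>i\<in>UNIV. \<Sum>j\<in>UNIV. c i j * x j)"
    unfolding sum_negf[symmetric] by (intro sum.cong refl) (metis assms mult_minus_left)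
  finally show ?thesis
    using 1 by (simp add: right_diff_distrib sum_subtractf)
qed

text \<open>The factor 2 reflects that the right side runs over ordered pairs, so each undirected
  edge is counted twice.\<close>

lemma inner_laplacian:
  fixes x :: "real ^ 'n"
  assumes "undirected M"
  shows "2 * (x \<bullet> (laplacian M *v x)) = (\<Sum>i\<in>UNIV. \<Sum>j\<in>UNIV. M $ i $ j * (x $ i - x $ j)\<^sup>2)"
proof -
  have "M $ j $ i * (x $ j - x $ i) = - (M $ i $ j * (x $ i - x $ j))" for i j
    using assms unfolding undirected_def by (metis minus_diff_eq mult_minus_right)
  from sum_antisymmetric_mult[OF this, of "\<lambda>i. x $ i"] show ?thesis
    by (simp add: inner_vec_def laplacian_mult power2_eq_square mult.assoc)
qed

lemma inner_laplacian_nonneg: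
  fixes x :: "real ^ 'n"
  assumes "adjacency_matrix M" "undirected M"
  shows "0 \<le> x \<bullet> (laplacian M *v x)"
proof -
  have "0 \<le> 2 * (x \<bullet> (laplacian M *v x))"
    unfolding inner_laplacian[OF assms(2)] using assms(1)
    by (intro sum_nonneg) (simp add: adjacency_matrix_def)
  thus ?thesis by simp
qed

text \<open>Nonnegativity of the quadratic form bounds the Rayleigh quotients below by 0, so the
  \<open>Inf\<close> in \<open>lambda2\<close> really is a lower bound. The multiplied-out form also
  covers \<open>x = 0\<close>.\<close>

lemma lambda2_laplacian_le:
  fixes x :: "real ^ 'n"
  assumes "adjacency_matrix M" "undirected M" "x \<bullet> (\<chi> i. 1) = 0"
  shows "lambda2 (laplacian M) * (x \<bullet> x) \<le> x \<bullet> (laplacian M *v x)"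
proof (cases "x = 0")
  case False
  have "lambda2 (laplacian M) \<le> (x \<bullet> (laplacian M *v x)) / (x \<bullet> x)"
    unfolding lambda2_def
  proof (rule cInf_lower)
    show "bdd_below {(x \<bullet> (laplacian M *v x)) / (x \<bullet> x) | x. x \<noteq> 0 \<and> x \<bullet> (\<chi> i. 1) = 0}"
      by (rule bdd_belowI[of _ 0]) (use inner_laplacian_nonneg[OF assms(1,2)] in auto)
  qed (use False assms(3) in blast)
  thus ?thesis using False by (simp add: field_simps)
qed simp

text \<open>If the form vanished, so would each edge term, and \<open>x\<close> would be constant
  along edges, hence along paths, hence on the whole graph. A constant vector orthogonal to the
  all-ones vector is 0.\<close>

lemma inner_laplacian_pos:
  fixes x :: "real ^ 'n"
  assumes "adjacency_matrix M" "undirected M" "connected_graph M"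
    and "x \<bullet> (\<chi> i. 1) = 0" "x \<noteq> 0"
  shows "0 < x \<bullet> (laplacian M *v x)"
proof (rule ccontr)
  assume "\<not> ?thesis"
  hence "2 * (x \<bullet> (laplacian M *v x)) = 0"
    using inner_laplacian_nonneg[OF assms(1,2), of x] by simp
  hence "(\<Sum>i\<in>UNIV. \<Sum>j\<in>UNIV. M $ i $ j * (x $ i - x $ j)\<^sup>2) = 0"
    by (simp only: inner_laplacian[OF assms(2)])
  hence zero: "M $ i $ j * (x $ i - x $ j)\<^sup>2 = 0" for i j
    using assms(1) by (simp add: adjacency_matrix_def sum_nonneg sum_nonneg_eq_0_iff)
  have "x $ i = x $ j" if "(i, j) \<in> {(p, q). M $ p $ q > 0}\<^sup>+" for i j
    using that
  proof induction
    case (base j) thus ?case using zero[of i j] by auto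
  next
    case (step j l) thus ?case using zero[of j l] by auto
  qed
  hence eq: "x $ i = x $ j" for i j
    using assms(3) unfolding connected_graph_def by (cases "i = j") auto
  fix i0 :: 'n
  have "x \<bullet> (\<chi> i. 1) = (\<Sum>i\<in>(UNIV :: 'n set). x $ i0)"
    unfolding inner_vec_def by (intro sum.cong refl) (auto intro: eq)
  hence "x $ i0 = 0" using assms(4) by simp
  hence "x = 0" unfolding vec_eq_iff zero_index using eq[of _ i0] by metis
  with assms(5) show False ..
qed

text \<open>Rayleigh quotients are invariant under scaling, so they are bounded below by the minimum
  of the form on the unit sphere within the hyperplane orthogonal to the all-ones vector. That
  minimum is attained by compactness and is positive by \<open>inner_laplacian_pos\<close>.\<close>

lemma lambda2_laplacian_pos:
  fixes M :: "real ^ 'n ^ 'n"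
  assumes "adjacency_matrix M" "undirected M" "connected_graph M" "CARD('n) \<ge> 2"
  shows "0 < lambda2 (laplacian M)"
proof -
  let ?S = "sphere 0 1 \<inter> {x. (\<chi> i. 1) \<bullet> x = 0} :: (real ^ 'n) set"
  obtain a b :: 'n where ab: "a \<noteq> b"
    using assms(4) card_le_Suc0_iff_eq[of "UNIV :: 'n set"] by auto
  \<comment> \<open>Two distinct vertices provide an admissible vector, so that the set under the
    \<open>Inf\<close> is nonempty.\<close>
  define z :: "real ^ 'n" where "z = axis a 1 - axis b 1"
  have "z $ a = 1" using ab by (simp add: z_def axis_def)
  hence z: "z \<noteq> 0" by auto
  have z': "z \<bullet> (\<chi> i. 1) = 0"
    by (simp add: z_def inner_diff_left inner_axis')
  have unit: "(1 / norm x) *\<^sub>R x \<in> ?S" if "x \<noteq> 0" "x \<bullet> (\<chi> i. 1) = 0" for x :: "real ^ 'n"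
    using that by (simp add: inner_commute)
  have "compact ?S" by (intro compact_Int_closed compact_sphere closed_hyperplane)
  moreover have "?S \<noteq> {}" using unit[OF z z'] by blast
  moreover have "continuous_on ?S (\<lambda>x. x \<bullet> (laplacian M *v x))"
    by (intro continuous_intros linear_continuous_on matrix_vector_mul_bounded_linear)
  ultimately obtain u where u: "u \<in> ?S"
    and min: "\<And>x. x \<in> ?S \<Longrightarrow> u \<bullet> (laplacian M *v u) \<le> x \<bullet> (laplacian M *v x)"
    using continuous_attains_inf[of ?S "\<lambda>x. x \<bullet> (laplacian M *v x)"] by blast
  have "0 < u \<bullet> (laplacian M *v u)"
    using u by (intro inner_laplacian_pos assms) (auto simp: inner_commute)
  also have "\<dots> \<le> lambda2 (laplacian M)"
    unfolding lambda2_def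
  proof (rule cInf_greatest)
    show "{(x \<bullet> (laplacian M *v x)) / (x \<bullet> x) | x. x \<noteq> 0 \<and> x \<bullet> (\<chi> i. 1) = 0} \<noteq> {}"
      using z z' by blast
  next
    fix r assume "r \<in> {(x \<bullet> (laplacian M *v x)) / (x \<bullet> x) | x. x \<noteq> 0 \<and> x \<bullet> (\<chi> i. 1) = 0}"
    then obtain x where x: "x \<noteq> 0" "x \<bullet> (\<chi> i. 1) = 0"
      and r: "r = (x \<bullet> (laplacian M *v x)) / (x \<bullet> x)" by blast
    have "r = ((1 / norm x) *\<^sub>R x) \<bullet> (laplacian M *v ((1 / norm x) *\<^sub>R x))"
      using x(1) unfolding r
      by (simp add: matrix_vector_mult_scaleR power2_norm_eq_inner[symmetric] power2_eq_square)
    with min[OF unit[OF x]] show "u \<bullet> (laplacian M *v u) \<le> r" by simp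
  qed
  finally show ?thesis .
qed

text \<open>Transfers connectivity from \<open>A\<close> to \<open>E\<close>, \<open>B\<close> and
  \<open>P\<close>, which have positive entries wherever \<open>A\<close> has.\<close>

lemma connected_graph_mono:
  assumes "connected_graph M" "\<And>i j. M $ i $ j > 0 \<Longrightarrow> M' $ i $ j > 0"
  shows "connected_graph M'"
proof -
  have "{(p, q). M $ p $ q > 0} \<subseteq> {(p, q). M' $ p $ q > 0}" using assms(2) by auto
  from trancl_mono[OF _ this] assms(1) show ?thesis by (simp add: connected_graph_def)
qed

text \<open>This is the orthogonal projection onto the complement of the constants: it keeps all
  pairwise differences, and its sum 0 makes it admissible in the Rayleigh quotient.\<close>

definition deviation :: "('n::finite \<Rightarrow> real) \<Rightarrow> 'n \<Rightarrow> real" where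
  "deviation v i = v i - (\<Sum>j\<in>UNIV. v j) / real CARD('n)"

lemma sum_deviation: "(\<Sum>i\<in>UNIV. deviation v i) = 0"
  by (simp add: deviation_def sum_subtractf)

lemma deviation_diff: "deviation v i - deviation v j = v i - v j"
  by (simp add: deviation_def)

lemma lambda2_deviation_le:
  assumes "adjacency_matrix M" "undirected M"
  shows "2 * lambda2 (laplacian M) * (\<Sum>i\<in>UNIV. (deviation v i)\<^sup>2)
    \<le> (\<Sum>i\<in>UNIV. \<Sum>j\<in>UNIV. M $ i $ j * (v i - v j)\<^sup>2)"
proof -
  let ?x = "\<chi> i. deviation v i"
  have "?x \<bullet> (\<chi> i. 1) = 0" by (simp add: inner_vec_def sum_deviation)
  from lambda2_laplacian_le[OF assms this]
  have "2 * (lambda2 (laplacian M) * (?x \<bullet> ?x)) \<le> 2 * (?x \<bullet> (laplacian M *v ?x))" by simp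
  thus ?thesis
    unfolding inner_laplacian[OF assms(2)]
    by (simp add: inner_vec_def deviation_diff power2_eq_square)
qed

section \<open>Power means\<close>

text \<open>The ratios \<open>z i / s\<close> lie in \<open>[0,1]\<close>, where
  \<open>r \<le> r powr \<alpha>\<close>, and they add up to 1. Multiplying by
  \<open>s powr \<alpha>\<close> and summing gives the claim.\<close>

lemma powr_sum_le:
  fixes z :: "'a \<Rightarrow> real"
  assumes "\<alpha> \<le> 1" "finite S" "\<And>i. i \<in> S \<Longrightarrow> 0 \<le> z i"
  shows "(\<Sum>i\<in>S. z i) powr \<alpha> \<le> (\<Sum>i\<in>S. z i powr \<alpha>)"
proof -
  define s where "s = (\<Sum>i\<in>S. z i)"
  show ?thesis
  proof (cases "s = 0")
    case True thus ?thesis by (simp add: s_def[symmetric] sum_nonneg)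
  next
    case False
    hence s: "s > 0" using assms(3) by (simp add: s_def sum_nonneg order_less_le)
    have "s powr \<alpha> * (z i / s) \<le> z i powr \<alpha>" if i: "i \<in> S" for i
    proof (cases "z i = 0")
      case False
      have "z i \<le> s" unfolding s_def using assms i by (intro member_le_sum) auto
      hence r: "0 < z i / s" "z i / s \<le> 1" using False s assms(3)[OF i] by auto
      hence "z i / s \<le> (z i / s) powr \<alpha>"
        using powr_mono'[OF assms(1), of "z i / s"] by (simp only: powr_one less_imp_le)
      hence "s powr \<alpha> * (z i / s) \<le> s powr \<alpha> * (z i / s) powr \<alpha>"
        by (intro mult_left_mono) auto
      also have "\<dots> = z i powr \<alpha>" using s assms(3)[OF i] by (simp add: powr_divide)
      finally show ?thesis .
    qed simp
    hence "(\<Sum>i\<in>S. s powr \<alpha> * (z i / s)) \<le> (\<Sum>i\<in>S. z i powr \<alpha>)" by (rule sum_mono)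
    moreover have "(\<Sum>i\<in>S. s powr \<alpha> * (z i / s)) = s powr \<alpha>"
      using s by (simp add: sum_distrib_left[symmetric] sum_divide_distrib[symmetric] s_def[symmetric])
    ultimately show ?thesis by (simp add: s_def)
  qed
qed

text \<open>Jensen's inequality for the convex power, applied to the positive summands only. Passing
  from their number to \<open>card S\<close> weakens the bound, as the exponent
  \<open>1 - \<beta>\<close> is not positive.\<close>

lemma sum_powr_power_mean:
  fixes z :: "'a \<Rightarrow> real"
  assumes "\<beta> \<ge> 1" "finite S" "\<And>i. i \<in> S \<Longrightarrow> 0 \<le> z i"
  shows "real (card S) powr (1 - \<beta>) * (\<Sum>i\<in>S. z i) powr \<beta> \<le> (\<Sum>i\<in>S. z i powr \<beta>)"
proof -
  define T where "T = {i \<in> S. z i \<noteq> 0}"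
  have T: "finite T" "T \<subseteq> S" and pos: "\<And>i. i \<in> T \<Longrightarrow> 0 < z i"
    using assms by (auto simp: T_def order_less_le)
  have sums: "(\<Sum>i\<in>S. z i) = (\<Sum>i\<in>T. z i)" "(\<Sum>i\<in>S. z i powr \<beta>) = (\<Sum>i\<in>T. z i powr \<beta>)"
    using assms(2) by (auto intro!: sum.mono_neutral_right simp: T_def)
  show ?thesis
  proof (cases "T = {}")
    case True thus ?thesis by (simp add: sums)
  next
    case False
    define n where "n = real (card T)"
    have n: "n > 0" using False T by (simp add: n_def card_gt_0_iff)
    have "(\<Sum>i\<in>T. (1 / n) *\<^sub>R z i) powr \<beta> \<le> (\<Sum>i\<in>T. (1 / n) * (z i powr \<beta>))"
      using T False pos n by (intro convex_on_sum[OF _ _ powr_convex[OF assms(1)]])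
        (auto simp: n_def[symmetric])
    hence "((\<Sum>i\<in>T. z i) / n) powr \<beta> \<le> (\<Sum>i\<in>T. z i powr \<beta>) / n"
      by (simp add: sum_divide_distrib)
    hence "n * ((\<Sum>i\<in>T. z i) / n) powr \<beta> \<le> (\<Sum>i\<in>T. z i powr \<beta>)"
      using n by (simp add: field_simps)
    moreover have "n * ((\<Sum>i\<in>T. z i) / n) powr \<beta> = n powr (1 - \<beta>) * (\<Sum>i\<in>T. z i) powr \<beta>"
      using n by (simp add: powr_divide sum_nonneg pos less_imp_le powr_diff)
    ultimately have *: "n powr (1 - \<beta>) * (\<Sum>i\<in>T. z i) powr \<beta> \<le> (\<Sum>i\<in>T. z i powr \<beta>)" by simp
    have "real (card S) powr (1 - \<beta>) \<le> n powr (1 - \<beta>)"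
      using n assms(1,2) T by (intro powr_mono2') (auto simp: n_def card_mono)
    hence "real (card S) powr (1 - \<beta>) * (\<Sum>i\<in>T. z i) powr \<beta> \<le> n powr (1 - \<beta>) * (\<Sum>i\<in>T. z i) powr \<beta>"
      by (intro mult_right_mono) auto
    with * show ?thesis by (simp add: sums)
  qed
qed

text \<open>A weight \<open>a i\<close> is moved inside the power as
  \<open>a i powr (1 / \<alpha>)\<close>. This is the origin of the matrix \<open>B\<close>; the
  convex counterpart below leads to \<open>P\<close> in the same way.\<close>

lemma sum_mult_powr_concave:
  fixes a w :: "'a \<Rightarrow> real"
  assumes "0 < \<alpha>" "\<alpha> \<le> 1" "finite S" "\<And>i. i \<in> S \<Longrightarrow> 0 \<le> a i" "\<And>i. i \<in> S \<Longrightarrow> 0 \<le> w i"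
  shows "(\<Sum>i\<in>S. a i powr (1 / \<alpha>) * w i) powr \<alpha> \<le> (\<Sum>i\<in>S. a i * w i powr \<alpha>)"
proof -
  have "(\<Sum>i\<in>S. a i powr (1 / \<alpha>) * w i) powr \<alpha> \<le> (\<Sum>i\<in>S. (a i powr (1 / \<alpha>) * w i) powr \<alpha>)"
    using assms by (intro powr_sum_le) auto
  also have "\<dots> = (\<Sum>i\<in>S. a i * w i powr \<alpha>)"
    using assms by (intro sum.cong refl) (simp add: powr_mult powr_powr)
  finally show ?thesis .
qed

lemma sum_mult_powr_convex:
  fixes a w :: "'a \<Rightarrow> real"
  assumes "1 \<le> \<beta>" "finite S" "\<And>i. i \<in> S \<Longrightarrow> 0 \<le> a i" "\<And>i. i \<in> S \<Longrightarrow> 0 \<le> w i"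
  shows "real (card S) powr (1 - \<beta>) * (\<Sum>i\<in>S. a i powr (1 / \<beta>) * w i) powr \<beta> \<le> (\<Sum>i\<in>S. a i * w i powr \<beta>)"
proof -
  have "real (card S) powr (1 - \<beta>) * (\<Sum>i\<in>S. a i powr (1 / \<beta>) * w i) powr \<beta>
      \<le> (\<Sum>i\<in>S. (a i powr (1 / \<beta>) * w i) powr \<beta>)"
    using assms by (intro sum_powr_power_mean) auto
  also have "\<dots> = (\<Sum>i\<in>S. a i * w i powr \<beta>)"
    using assms by (intro sum.cong refl) (simp add: powr_mult powr_powr)
  finally show ?thesis .
qed

section \<open>Closed loop at a point\<close>

text \<open>Cauchy-Schwarz bounds the disturbance by \<open>D * sqrt N * dmax\<close>, with
  \<open>N\<close> the number of agents. In the other direction the sum of the weighted differences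
  dominates their Euclidean norm, whose square carries the weights of \<open>E\<close>, and
  \<open>lambda2\<close> bounds that norm below by a multiple of \<open>D\<close>.\<close>

lemma sum_deviation_disturbance_le:
  fixes A :: "real ^ 'n ^ 'n" and v \<delta> :: "'n \<Rightarrow> real"
  assumes A: "adjacency_matrix A" "undirected A"
    and E: "E = (\<chi> i j. (A $ i $ j)\<^sup>2)" and lam: "0 < lambda2 (laplacian E)"
    and \<delta>: "\<And>i. \<bar>\<delta> i\<bar> \<le> dmax"
    and dbar: "2 * dmax * real CARD('n) powr (1 / 2) / (sqrt 2 * lambda2 (laplacian E) powr (1 / 2)) \<le> dbar"
  shows "2 * (\<Sum>i\<in>UNIV. deviation v i * \<delta> i) \<le> dbar * (\<Sum>i\<in>UNIV. \<Sum>j\<in>UNIV. A $ i $ j * \<bar>v i - v j\<bar>)"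
proof -
  let ?l = "lambda2 (laplacian E)" and ?N = "real CARD('n)"
  define D where "D = L2_set (deviation v) UNIV"
  define X where "X = (\<Sum>i\<in>UNIV. \<Sum>j\<in>UNIV. A $ i $ j * \<bar>v i - v j\<bar>)"
  \<comment> \<open>Any agent will do, since the bound dominates an absolute value.\<close>
  have dmax: "0 \<le> dmax" using \<delta>[of undefined] by linarith
  have D0: "0 \<le> D" by (simp add: D_def L2_set_nonneg)
  have "(\<Sum>i\<in>UNIV. deviation v i * \<delta> i) \<le> (\<Sum>i\<in>UNIV. \<bar>deviation v i\<bar> * \<bar>\<delta> i\<bar>)"
    by (intro sum_mono) (metis abs_ge_self abs_mult)
  also have "\<dots> \<le> D * L2_set \<delta> UNIV" unfolding D_def by (rule L2_set_mult_ineq)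
  also have "L2_set \<delta> UNIV \<le> L2_set (\<lambda>i. dmax) (UNIV :: 'n set)"
    unfolding L2_set_def using \<delta> dmax
    by (intro real_sqrt_le_mono sum_mono) (metis abs_ge_zero power2_abs power_mono)
  also have "L2_set (\<lambda>i. dmax) (UNIV :: 'n set) = sqrt ?N * dmax"
    using dmax by (simp add: L2_set_constant)
  finally have 1: "(\<Sum>i\<in>UNIV. deviation v i * \<delta> i) \<le> D * (sqrt ?N * dmax)"
    using D0 by (simp add: mult_left_mono)
  have EE: "adjacency_matrix E" "undirected E"
    using A by (auto simp: E adjacency_matrix_def undirected_def)
  have "sqrt 2 * sqrt ?l * D = sqrt (2 * ?l * (\<Sum>i\<in>UNIV. (deviation v i)\<^sup>2))"
    by (simp add: D_def L2_set_def real_sqrt_mult)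
  also have "\<dots> \<le> sqrt (\<Sum>i\<in>UNIV. \<Sum>j\<in>UNIV. E $ i $ j * (v i - v j)\<^sup>2)"
    by (intro real_sqrt_le_mono lambda2_deviation_le EE)
  also have "\<dots> = L2_set (\<lambda>(i, j). A $ i $ j * \<bar>v i - v j\<bar>) (UNIV \<times> UNIV)"
    by (simp add: L2_set_def E power_mult_distrib sum.cartesian_product case_prod_beta)
  also have "\<dots> \<le> (\<Sum>(i, j)\<in>UNIV \<times> UNIV. A $ i $ j * \<bar>v i - v j\<bar>)"
    using A(1) by (intro L2_set_le_sum) (auto simp: adjacency_matrix_def)
  also have "\<dots> = X" by (simp add: X_def sum.cartesian_product)
  finally have 2: "sqrt 2 * sqrt ?l * D \<le> X" .
  \<comment> \<open>Expanding by \<open>sqrt 2 * sqrt ?l\<close> exhibits exactly the threshold that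
    \<open>dbar\<close> exceeds.\<close>
  have "2 * (D * (sqrt ?N * dmax)) = (2 * dmax * sqrt ?N / (sqrt 2 * sqrt ?l)) * (sqrt 2 * sqrt ?l * D)"
    using lam by simp
  also have "\<dots> \<le> dbar * (sqrt 2 * sqrt ?l * D)"
    using dbar lam D0 by (intro mult_right_mono) (simp_all add: powr_half_sqrt)
  also have "\<dots> \<le> dbar * X"
  proof (intro mult_left_mono 2)
    show "0 \<le> dbar"
      by (rule order_trans[OF _ dbar]) (use dmax lam in simp)
  qed
  finally show ?thesis using 1 by (simp add: X_def)
qed

text \<open>The control is a sum of antisymmetric couplings \<open>c i j\<close>, so testing it with
  the deviations produces differences only. Its sign part absorbs the disturbance, its power part is
  the dissipation, and the diffusion term is kept for integration over space.\<close>

lemma sum_deviation_closed_loop_le: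
  fixes A :: "real ^ 'n ^ 'n" and y :: "'n \<Rightarrow> real \<Rightarrow> real \<Rightarrow> real"
  assumes A: "adjacency_matrix A" "undirected A"
    and E: "E = (\<chi> i j. (A $ i $ j)\<^sup>2)" and lam: "0 < lambda2 (laplacian E)"
    and \<delta>: "\<And>i. \<bar>\<delta> i\<bar> \<le> dmax"
    and dbar: "2 * dmax * real CARD('n) powr (1 / 2) / (sqrt 2 * lambda2 (laplacian E) powr (1 / 2)) \<le> dbar"
    and \<sigma>: "admissible_signs (\<lambda>i. y i x t) \<sigma>"
    and eq: "\<And>i. yt i = k * yxx i + control A L \<alpha> \<beta> dbar y \<sigma> i x t + \<delta> i"
  defines "v \<equiv> \<lambda>i. y i x t" and "w \<equiv> \<lambda>i j. integral {0..L} (\<lambda>z. (y i z t - y j z t)\<^sup>2)"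
  shows "2 * (\<Sum>i\<in>UNIV. deviation v i * yt i) \<le> 2 * k * (\<Sum>i\<in>UNIV. deviation v i * yxx i)
    - (\<Sum>i\<in>UNIV. \<Sum>j\<in>UNIV. A $ i $ j * (w i j powr (\<alpha> - 1) + w i j powr (\<beta> - 1)) * (v i - v j)\<^sup>2)"
proof -
  define c where "c i j = A $ i $ j * (w i j powr (\<alpha> - 1) + w i j powr (\<beta> - 1)) * (v i - v j)
    + dbar * A $ i $ j * \<sigma> i j" for i j
  have w: "w j i = w i j" for i j
    unfolding w_def by (intro arg_cong[where f = "integral {0..L}"] ext power2_commute)
  have antisym: "c j i = - c i j" for i j
  proof -
    have "A $ j $ i = A $ i $ j" "\<sigma> j i = - \<sigma> i j"
      using A(2) \<sigma> unfolding undirected_def admissible_signs_def by blast+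
    thus ?thesis unfolding c_def w[of j i] by (simp add: algebra_simps)
  qed
  have ctrl: "control A L \<alpha> \<beta> dbar y \<sigma> i x t = - (\<Sum>j\<in>UNIV. c i j)" for i
    by (simp add: control_def c_def w_def v_def sum.distrib sum_subtractf algebra_simps sum_distrib_left)
  \<comment> \<open>This also holds where two states meet: there the selected sign is arbitrary in
    \<open>[-1,1]\<close>, but it multiplies 0.\<close>
  have \<sigma>abs: "\<sigma> i j * (v i - v j) = \<bar>v i - v j\<bar>" for i j
  proof -
    have "\<sigma> i j \<in> sign_set (v i - v j)" using \<sigma> unfolding admissible_signs_def v_def by blast
    thus ?thesis by (cases "v i - v j = 0") (auto simp: sign_set_def abs_sgn mult.commute)
  qed
  have "2 * (\<Sum>i\<in>UNIV. deviation v i * yt i) = 2 * k * (\<Sum>i\<in>UNIV. deviation v i * yxx i)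
      - 2 * (\<Sum>i\<in>UNIV. deviation v i * (\<Sum>j\<in>UNIV. c i j)) + 2 * (\<Sum>i\<in>UNIV. deviation v i * \<delta> i)"
    by (simp add: eq ctrl algebra_simps sum.distrib sum_subtractf sum_distrib_left)
  also have "2 * (\<Sum>i\<in>UNIV. deviation v i * (\<Sum>j\<in>UNIV. c i j))
      = (\<Sum>i\<in>UNIV. \<Sum>j\<in>UNIV. c i j * (v i - v j))"
    using sum_antisymmetric_mult[OF antisym, of "deviation v"] by (simp add: deviation_diff)
  also have "\<dots> = (\<Sum>i\<in>UNIV. \<Sum>j\<in>UNIV. A $ i $ j * (w i j powr (\<alpha> - 1) + w i j powr (\<beta> - 1)) * (v i - v j)\<^sup>2)
      + dbar * (\<Sum>i\<in>UNIV. \<Sum>j\<in>UNIV. A $ i $ j * \<bar>v i - v j\<bar>)"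
    unfolding sum_distrib_left sum.distrib[symmetric] c_def \<sigma>abs[symmetric]
    by (intro sum.cong refl) (simp add: algebra_simps power2_eq_square)
  finally show ?thesis
    using sum_deviation_disturbance_le[OF A E lam \<delta> dbar, of v] by simp
qed

section \<open>Absolutely continuous functions\<close>

lemma integrable_lborel_prod_mult:
  fixes p q :: "real \<Rightarrow> real"
  assumes p: "integrable lborel p" and q: "integrable lborel q"
  shows "integrable (lborel \<Otimes>\<^sub>M lborel) (\<lambda>(s, t). p s * q t)"
proof (rule lborel_pair.Fubini_integrable)
  have [measurable]: "p \<in> borel_measurable borel" "q \<in> borel_measurable borel"
    using p q by auto
  show "(\<lambda>(s, t). p s * q t) \<in> borel_measurable (lborel \<Otimes>\<^sub>M lborel)" by measurable
  show "integrable lborel (\<lambda>s. \<integral>t. norm (case (s, t) of (s, t) \<Rightarrow> p s * q t) \<partial>lborel)"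
    using p by (simp add: abs_mult)
  show "AE s in lborel. integrable lborel (\<lambda>t. case (s, t) of (s, t) \<Rightarrow> p s * q t)"
    using q by simp
qed

text \<open>Splitting the square along its diagonal turns the product of the two integrals into the two
  terms of the product rule.\<close>

lemma integral_mult_primitive:
  fixes p q :: "real \<Rightarrow> real"
  assumes p: "integrable lborel p" and q: "integrable lborel q"
  shows "integral\<^sup>L lborel p * integral\<^sup>L lborel q
    = (\<integral>t. q t * (\<integral>s. indicator {..t} s * p s \<partial>lborel) \<partial>lborel)
      + (\<integral>s. p s * (\<integral>t. indicator {..s} t * q t \<partial>lborel) \<partial>lborel)"
proof -
  have [measurable]: "p \<in> borel_measurable borel" "q \<in> borel_measurable borel"
    using p q by auto
  let ?h = "\<lambda>s t. p s * q t"
  let ?u = "\<lambda>s t. indicator {..t} s * ?h s t" and ?v = "\<lambda>s t. indicator {..<s} t * ?h s t"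
  have h: "integrable (lborel \<Otimes>\<^sub>M lborel) (\<lambda>(s, t). ?h s t)"
    by (rule integrable_lborel_prod_mult[OF p q])
  have le[measurable]: "(\<lambda>(s, t). indicator {..t::real} s :: real) \<in> borel_measurable (lborel \<Otimes>\<^sub>M lborel)"
    "(\<lambda>(s, t). indicator {..<s::real} t :: real) \<in> borel_measurable (lborel \<Otimes>\<^sub>M lborel)"
    unfolding indicator_def of_bool_def atMost_iff lessThan_iff by measurable
  have u: "integrable (lborel \<Otimes>\<^sub>M lborel) (\<lambda>(s, t). ?u s t)"
    by (rule Bochner_Integration.integrable_bound[OF h]) (auto simp: indicator_def)
  have v: "integrable (lborel \<Otimes>\<^sub>M lborel) (\<lambda>(s, t). ?v s t)"
    by (rule Bochner_Integration.integrable_bound[OF h]) (auto simp: indicator_def)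
  have "integral\<^sup>L lborel p * integral\<^sup>L lborel q = (\<integral>s. (\<integral>t. ?h s t \<partial>lborel) \<partial>lborel)"
    by simp
  also have "\<dots> = (\<integral>z. (case z of (s, t) \<Rightarrow> ?h s t) \<partial>(lborel \<Otimes>\<^sub>M lborel))"
    by (rule lborel_pair.integral_fst[OF h])
  also have "\<dots> = (\<integral>z. (case z of (s, t) \<Rightarrow> ?u s t) + (case z of (s, t) \<Rightarrow> ?v s t) \<partial>(lborel \<Otimes>\<^sub>M lborel))"
    by (rule Bochner_Integration.integral_cong) (auto simp: indicator_def)
  also have "\<dots> = (\<integral>z. (case z of (s, t) \<Rightarrow> ?u s t) \<partial>(lborel \<Otimes>\<^sub>M lborel))
      + (\<integral>z. (case z of (s, t) \<Rightarrow> ?v s t) \<partial>(lborel \<Otimes>\<^sub>M lborel))"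
    by (rule Bochner_Integration.integral_add[OF u v])
  also have "(\<integral>z. (case z of (s, t) \<Rightarrow> ?u s t) \<partial>(lborel \<Otimes>\<^sub>M lborel)) = (\<integral>t. (\<integral>s. ?u s t \<partial>lborel) \<partial>lborel)"
    by (rule lborel_pair.integral_snd[OF u, symmetric])
  also have "\<dots> = (\<integral>t. q t * (\<integral>s. indicator {..t} s * p s \<partial>lborel) \<partial>lborel)"
    by (intro Bochner_Integration.integral_cong refl)
       (simp flip: integral_mult_right_zero, simp add: mult.left_commute mult.commute)
  also have "(\<integral>z. (case z of (s, t) \<Rightarrow> ?v s t) \<partial>(lborel \<Otimes>\<^sub>M lborel)) = (\<integral>s. (\<integral>t. ?v s t \<partial>lborel) \<partial>lborel)"
    by (rule lborel_pair.integral_fst[OF v, symmetric])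
  also have "\<dots> = (\<integral>s. p s * (\<integral>t. indicator {..s} t * q t \<partial>lborel) \<partial>lborel)"
  proof (intro Bochner_Integration.integral_cong refl)
    fix s
    have "(\<integral>t. ?v s t \<partial>lborel) = (\<integral>t. p s * (indicator {..<s} t * q t) \<partial>lborel)"
      by (simp add: mult.left_commute)
    also have "\<dots> = p s * (\<integral>t. indicator {..<s} t * q t \<partial>lborel)" by (rule integral_mult_right_zero)
    \<comment> \<open>The diagonal was assigned to \<open>?u\<close>, so \<open>?v\<close> has the
      half-line without its endpoint. Adding the endpoint changes only a null set.\<close>
    also have "(\<integral>t. indicator {..<s} t * q t \<partial>lborel) = (\<integral>t. indicator {..s} t * q t \<partial>lborel)"
      using AE_lborel_singleton[of s]
      by (intro integral_cong_AE) (auto simp: indicator_def elim: eventually_mono)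
    finally show "(\<integral>t. ?v s t \<partial>lborel) = p s * (\<integral>t. indicator {..s} t * q t \<partial>lborel)" .
  qed
  finally show ?thesis .
qed

text \<open>\<open>absolutely_integrable_on\<close> speaks of Lebesgue measurable functions, whereas
  the Fubini argument on \<open>lborel\<close> needs Borel ones. A Lebesgue measurable function
  agrees almost everywhere with a Borel function.\<close>

lemma absolutely_integrable_on_lborel_version:
  fixes f :: "real \<Rightarrow> real"
  assumes "f absolutely_integrable_on {a..b}"
  obtains p where "integrable lborel p" "AE x in lborel. p x = indicator {a..b} x * f x"
proof -
  have int: "integrable lebesgue (\<lambda>x. indicator {a..b} x * f x)"
    using assms by (simp add: set_integrable_def)
  obtain p where p: "p \<in> borel_measurable lborel" "AE x in lborel. indicator {a..b} x * f x = p x"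
    using completion_ex_borel_measurable_real[OF borel_measurable_integrable[OF int]] by blast
  define q where "q x = indicator {a..b} x * p x" for x
  have q: "q \<in> borel_measurable lborel" unfolding q_def using p(1) by measurable
  have ae: "AE x in lborel. q x = indicator {a..b} x * f x"
    using p(2) unfolding q_def by eventually_elim (erule subst, simp add: indicator_def)
  have "integrable lebesgue q"
    using q ae by (intro integrable_cong_AE_imp[OF int]) (auto intro: AE_completion measurable_completion)
  hence "integrable lborel q" using q integrable_completion by blast
  thus ?thesis using ae by (rule that)
qed

lemma ac_derivative_on_subset:
  "ac_derivative_on f f' S \<Longrightarrow> T \<subseteq> S \<Longrightarrow> ac_derivative_on f f' T"
  unfolding ac_derivative_on_def by blast

lemma ac_derivative_onD:
  assumes "ac_derivative_on f f' S" "a \<in> S" "b \<in> S" "a \<le> b"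
  shows "f' absolutely_integrable_on {a..b}" "integral {a..b} f' = f b - f a"
  using assms unfolding ac_derivative_on_def by blast+

lemma ac_derivative_on_continuous_on:
  assumes "ac_derivative_on f f' {a..b}"
  shows "continuous_on {a..b} f"
proof (cases "a \<le> b")
  case True
  have "continuous_on {a..b} (\<lambda>x. f a + integral {a..x} f')"
    using ac_derivative_onD(1)[OF assms, of a b] True
    by (intro continuous_intros indefinite_integral_continuous_1 set_lebesgue_integral_eq_integral) auto
  moreover have "f a + integral {a..x} f' = f x" if "x \<in> {a..b}" for x
    using ac_derivative_onD(2)[OF assms, of a x] that by auto
  ultimately show ?thesis by (rule continuous_on_eq)
qed auto

lemma absolutely_integrable_continuous_mult:
  fixes f g :: "real \<Rightarrow> real"
  assumes "continuous_on {a..b} f" "g absolutely_integrable_on {a..b}"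
  shows "(\<lambda>x. f x * g x) absolutely_integrable_on {a..b}"
proof (rule absolutely_integrable_bounded_measurable_product_real[OF _ _ _ assms(2)])
  show "f \<in> borel_measurable (lebesgue_on {a..b})"
    using assms(1) by (intro continuous_imp_measurable_on_sets_lebesgue) auto
  show "bounded (f ` {a..b})"
    using assms(1) by (intro compact_imp_bounded compact_continuous_image) auto
qed auto

lemma integral_lborel_version:
  fixes p f :: "real \<Rightarrow> real"
  assumes "integrable lborel p" "AE x in lborel. p x = indicator {a..b} x * f x"
    and "f absolutely_integrable_on {a..b}"
  shows "integral\<^sup>L lborel p = integral {a..b} f"
proof -
  have "((\<lambda>x. if x \<in> {a..b} then f x else 0) has_integral integral {a..b} f) UNIV"
    unfolding has_integral_restrict_UNIV using set_lebesgue_integral_eq_integral(1)[OF assms(3)]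
    by (rule integrable_integral)
  moreover have "AE x in lborel. x \<in> UNIV \<longrightarrow> (if x \<in> {a..b} then f x else 0) = p x"
    using assms(2) by eventually_elim (auto simp: indicator_def)
  ultimately have "(p has_integral integral {a..b} f) UNIV"
    by (subst (asm) has_integral_AE)
  thus ?thesis using has_integral_integral_lborel[OF assms(1)] by (metis has_integral_unique)
qed

text \<open>On \<open>[a,b]\<close> the inner integral is the increment \<open>g t - g a\<close>.
  Used twice with the roles of the factors exchanged, this evaluates both terms of
  \<open>integral_mult_primitive\<close>.\<close>

lemma primitive_mult_integral:
  fixes p q f' g g' :: "real \<Rightarrow> real"
  assumes "integrable lborel q" "AE x in lborel. q x = indicator {a..b} x * g' x"
    and p: "integrable lborel p" "AE x in lborel. p x = indicator {a..b} x * f' x"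
    and g: "ac_derivative_on g g' {a..b}"
    and "f' absolutely_integrable_on {a..b}"
  shows "(\<integral>t. p t * (\<integral>s. indicator {..t} s * q s \<partial>lborel) \<partial>lborel) = integral {a..b} (\<lambda>x. (g x - g a) * f' x)"
proof -
  have [measurable]: "p \<in> borel_measurable borel" "q \<in> borel_measurable borel"
    using assms(1) p(1) by auto
  have prim: "(\<integral>s. indicator {..t} s * q s \<partial>lborel) = g t - g a" if t: "t \<in> {a..b}" for t
  proof -
    have "(\<integral>s. indicator {..t} s * q s \<partial>lborel) = integral {a..t} g'"
    proof (rule integral_lborel_version)
      show "integrable lborel (\<lambda>s. indicator {..t} s * q s)"
        by (rule Bochner_Integration.integrable_bound[OF assms(1)]) (auto simp: indicator_def)
      show "AE x in lborel. indicator {..t} x * q x = indicator {a..t} x * g' x"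
        using assms(2) by eventually_elim (use t in \<open>auto simp: indicator_def\<close>)
      show "g' absolutely_integrable_on {a..t}"
        using ac_derivative_onD(1)[OF g, of a t] t by auto
    qed
    thus ?thesis using ac_derivative_onD(2)[OF g, of a t] t by auto
  qed
  let ?h = "\<lambda>t. p t * (\<integral>s. indicator {..t} s * q s \<partial>lborel)"
  have eq: "AE t in lborel. ?h t = indicator {a..b} t * ((g t - g a) * f' t)"
    using p(2) by eventually_elim (simp add: prim split: split_indicator)
  have ai: "(\<lambda>x. (g x - g a) * f' x) absolutely_integrable_on {a..b}"
    using assms(6) ac_derivative_on_continuous_on[OF g]
    by (intro absolutely_integrable_continuous_mult continuous_intros)
  have meas: "?h \<in> borel_measurable lborel"
    unfolding indicator_def of_bool_def atMost_iff by measurable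
  have "integrable lebesgue ?h"
  proof (rule integrable_cong_AE_imp)
    show "integrable lebesgue (\<lambda>t. indicator {a..b} t * ((g t - g a) * f' t))"
      using ai by (simp add: set_integrable_def)
    show "AE t in lebesgue. indicator {a..b} t * ((g t - g a) * f' t) = ?h t"
      using eq by (intro AE_completion) (auto simp: eq_commute)
  qed (use meas in \<open>auto intro: measurable_completion\<close>)
  hence "integrable lborel ?h" using meas integrable_completion by blast
  thus ?thesis using eq ai by (rule integral_lborel_version)
qed

text \<open>Product rule for absolutely continuous functions. By \<open>e2\<close> the product of
  the two increments is the integral of the product rule for \<open>f - f a\<close> and
  \<open>g - g a\<close>; the constants are restored at the end.\<close>

lemma ac_derivative_on_mult_Icc:
  fixes f g :: "real \<Rightarrow> real"
  assumes f: "ac_derivative_on f f' {a..b}" and g: "ac_derivative_on g g' {a..b}" and ab: "a \<le> b"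
  shows "(\<lambda>x. f' x * g x + f x * g' x) absolutely_integrable_on {a..b}" (is ?int)
    and "integral {a..b} (\<lambda>x. f' x * g x + f x * g' x) = f b * g b - f a * g a" (is ?eq)
proof -
  have cont: "continuous_on {a..b} f" "continuous_on {a..b} g"
    using f g by (auto intro: ac_derivative_on_continuous_on)
  have ai: "f' absolutely_integrable_on {a..b}" "g' absolutely_integrable_on {a..b}"
    using ac_derivative_onD(1)[OF f, of a b] ac_derivative_onD(1)[OF g, of a b] ab by auto
  have parts: "(\<lambda>x. (g x - c) * f' x) absolutely_integrable_on {a..b}"
    "(\<lambda>x. (f x - c) * g' x) absolutely_integrable_on {a..b}" for c
    using cont ai by (auto intro!: absolutely_integrable_continuous_mult continuous_intros)
  from set_integral_add(1)[OF parts(1)[of 0] parts(2)[of 0]] show ?int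
    by (simp add: mult.commute)
  have e1: "integral {a..b} f' = f b - f a" "integral {a..b} g' = g b - g a"
    using ac_derivative_onD(2)[OF f, of a b] ac_derivative_onD(2)[OF g, of a b] ab by auto
  have e2: "integral {a..b} f' * integral {a..b} g'
      = integral {a..b} (\<lambda>x. (f x - f a) * g' x) + integral {a..b} (\<lambda>x. (g x - g a) * f' x)"
  proof -
    obtain p q where p: "integrable lborel p" "AE x in lborel. p x = indicator {a..b} x * f' x"
      and q: "integrable lborel q" "AE x in lborel. q x = indicator {a..b} x * g' x"
      using absolutely_integrable_on_lborel_version ai by metis
    show ?thesis
      using integral_mult_primitive[OF p(1) q(1)]
      by (simp only: primitive_mult_integral[OF q(1,2) p(1,2) g ai(1)] primitive_mult_integral[OF p(1,2) q(1,2) f ai(2)]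
          integral_lborel_version[OF p(1,2) ai(1)] integral_lborel_version[OF q(1,2) ai(2)])
  qed
  have "integral {a..b} (\<lambda>x. f' x * g x + f x * g' x)
      = integral {a..b} (\<lambda>x. ((f x - f a) * g' x + (g x - g a) * f' x) + (f a * g' x + g a * f' x))"
    by (simp add: algebra_simps)
  also have "\<dots> = (integral {a..b} (\<lambda>x. (f x - f a) * g' x) + integral {a..b} (\<lambda>x. (g x - g a) * f' x))
      + (f a * integral {a..b} g' + g a * integral {a..b} f')"
    using parts ai
    by (subst Henstock_Kurzweil_Integration.integral_add Henstock_Kurzweil_Integration.integral_mult_right;
        (intro integrable_add integrable_on_mult_right)?; auto intro: set_lebesgue_integral_eq_integral(1))+
  finally show ?eq unfolding e2[symmetric] e1 by (simp add: algebra_simps)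
qed

text \<open>Integration by parts: the boundary terms \<open>f * f'\<close> vanish, so the integral
  equals minus the integral of the square of \<open>f'\<close>. This is the sign of the diffusion
  under Dirichlet conditions.\<close>

lemma ac_derivative_on_energy_nonpos:
  assumes f: "ac_derivative_on f f' {a..b}" and f': "ac_derivative_on f' f'' {a..b}"
    and bc: "f a = 0" "f b = 0" and ab: "a \<le> b"
  shows "(\<lambda>x. f x * f'' x) absolutely_integrable_on {a..b}"
    and "integral {a..b} (\<lambda>x. f x * f'' x) \<le> 0"
proof -
  have cont: "continuous_on {a..b} f" "continuous_on {a..b} f'"
    using f f' by (auto intro: ac_derivative_on_continuous_on)
  show ai: "(\<lambda>x. f x * f'' x) absolutely_integrable_on {a..b}"
    using cont ac_derivative_onD(1)[OF f', of a b] ab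
    by (intro absolutely_integrable_continuous_mult) auto
  have "0 = integral {a..b} (\<lambda>x. f' x * f' x + f x * f'' x)"
    using ac_derivative_on_mult_Icc(2)[OF f f' ab] bc by simp
  also have "\<dots> = integral {a..b} (\<lambda>x. f' x * f' x) + integral {a..b} (\<lambda>x. f x * f'' x)"
    using cont ai by (intro Henstock_Kurzweil_Integration.integral_add
        integrable_continuous_interval continuous_intros set_lebesgue_integral_eq_integral(1))
  moreover have "0 \<le> integral {a..b} (\<lambda>x. f' x * f' x)"
    using cont by (intro Henstock_Kurzweil_Integration.integral_nonneg
        integrable_continuous_interval continuous_intros) auto
  ultimately show "integral {a..b} (\<lambda>x. f x * f'' x) \<le> 0" by linarith
qed

lemma ac_derivative_on_deviation:
  fixes f f' :: "'n::finite \<Rightarrow> real \<Rightarrow> real"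
  assumes "\<And>j. ac_derivative_on (f j) (f' j) S"
  shows "ac_derivative_on (\<lambda>x. deviation (\<lambda>j. f j x) i) (\<lambda>x. deviation (\<lambda>j. f' j x) i) S"
  unfolding ac_derivative_on_def
proof (intro ballI impI)
  fix a b assume ab: "a \<in> S" "b \<in> S" "a \<le> b"
  note D = ac_derivative_onD[OF assms ab]
  note int = set_lebesgue_integral_eq_integral(1)[OF D(1)]
  have s: "(\<lambda>x. (\<Sum>j\<in>UNIV. f' j x) / real CARD('n)) absolutely_integrable_on {a..b}"
    using D(1) by (intro set_integrable_divide absolutely_integrable_sum) auto
  have "(\<lambda>x. deviation (\<lambda>j. f' j x) i) absolutely_integrable_on {a..b}"
    unfolding deviation_def using D(1) s by (rule set_integral_diff(1))
  moreover have "integral {a..b} (\<lambda>x. deviation (\<lambda>j. f' j x) i)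
      = integral {a..b} (f' i) - integral {a..b} (\<lambda>x. (\<Sum>j\<in>UNIV. f' j x) / real CARD('n))"
    unfolding deviation_def
    by (intro Henstock_Kurzweil_Integration.integral_diff int set_lebesgue_integral_eq_integral(1)[OF s])
  moreover have "integral {a..b} (\<lambda>x. (\<Sum>j\<in>UNIV. f' j x) / real CARD('n))
      = (\<Sum>j\<in>UNIV. integral {a..b} (f' j)) / real CARD('n)"
    by (simp add: Henstock_Kurzweil_Integration.integral_sum int)
  ultimately show "(\<lambda>x. deviation (\<lambda>j. f' j x) i) absolutely_integrable_on {a..b} \<and>
      integral {a..b} (\<lambda>x. deviation (\<lambda>j. f' j x) i) = deviation (\<lambda>j. f j b) i - deviation (\<lambda>j. f j a) i"
    by (simp add: D(2) deviation_def sum_subtractf diff_divide_distrib)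
qed

section \<open>Energy balance\<close>

text \<open>The exceptional set of \<open>P\<close> may fail to be measurable. It is enclosed in a
  measurable null set \<open>N\<close>, for which the order of the two quantifiers can be
  exchanged.\<close>

lemma AE_lborel_pair_swap:
  assumes "AE z in lborel. P (fst z) (snd (z :: real \<times> real))"
  shows "AE t in lborel. AE x in lborel. P x t"
proof -
  have "AE z in lborel \<Otimes>\<^sub>M lborel. P (fst z) (snd (z :: real \<times> real))"
    using assms unfolding lborel_prod .
  then obtain N where N: "{z \<in> space (lborel \<Otimes>\<^sub>M lborel). \<not> P (fst z) (snd z)} \<subseteq> N"
    "N \<in> null_sets (lborel \<Otimes>\<^sub>M lborel)"
    by (auto simp: eventually_ae_filter)
  have "AE x in lborel. AE t in lborel. (x, t) \<notin> N"
    using AE_not_in[OF N(2)] by (rule lborel_pair.AE_pair)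
  moreover have "{z \<in> space (lborel \<Otimes>\<^sub>M lborel). (fst z, snd z) \<notin> N} \<in> sets (lborel \<Otimes>\<^sub>M lborel)"
    unfolding prod.collapse set_diff_eq[symmetric] using N(2) by (intro sets.compl_sets null_setsD2)
  ultimately have "AE t in lborel. AE x in lborel. (x, t) \<notin> N"
    by (subst (asm) lborel_pair.AE_commute)
  moreover have "P x t" if "(x, t) \<notin> N" for x t
    using that subsetD[OF N(1), of "(x, t)"] by (auto simp: space_pair_measure)
  ultimately show ?thesis by (auto elim!: eventually_mono)
qed

text \<open>The rectangle has finite measure and
  \<open>\<bar>r\<bar> \<le> 1 + r\<^sup>2\<close>.\<close>

lemma locally_square_integrable_imp_set_integrable:
  assumes g: "locally_square_integrable L g" and ab: "0 < a" "a \<le> b"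
  shows "set_integrable lborel ({0..L} \<times> {a..b}) (\<lambda>(x, t). g x t)"
proof -
  let ?Q = "{0..L} \<times> {a..b}"
  have Q: "?Q = cbox (0, a) (L, b)" by (auto simp: cbox_Pair_eq)
  have meas: "(\<lambda>(x, t). g x t) \<in> borel_measurable lborel"
    using g by (simp add: locally_square_integrable_def measurable_lborel2)
  have sq: "set_integrable lborel ?Q (\<lambda>(x, t). (g x t)\<^sup>2)"
    using g ab by (simp add: locally_square_integrable_def)
  have one: "set_integrable lborel ?Q (\<lambda>z. 1 :: real)"
    unfolding set_integrable_def Q
    by (intro integrable_scaleR_left integrable_real_indicator emeasure_lborel_cbox_finite) auto
  have bound: "integrable lborel (\<lambda>z. indicator ?Q z *\<^sub>R (1 :: real) + indicator ?Q z *\<^sub>R (case z of (x, t) \<Rightarrow> (g x t)\<^sup>2))"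
    using one sq unfolding set_integrable_def by (rule Bochner_Integration.integrable_add)
  show ?thesis
    unfolding set_integrable_def
  proof (rule Bochner_Integration.integrable_bound[OF bound])
    show "(\<lambda>z. indicator ?Q z *\<^sub>R (case z of (x, t) \<Rightarrow> g x t)) \<in> borel_measurable lborel"
      by (rule borel_measurable_scaleR[OF borel_measurable_indicator meas]) (simp add: Q)
    have "\<bar>r\<bar> \<le> 1 + r\<^sup>2" for r :: real
      using sum_squares_bound[of 1 "\<bar>r\<bar>"] by (simp add: power2_eq_square)
    thus "AE z in lborel. norm (indicator ?Q z *\<^sub>R (case z of (x, t) \<Rightarrow> g x t))
        \<le> norm (indicator ?Q z *\<^sub>R (1 :: real) + indicator ?Q z *\<^sub>R (case z of (x, t) \<Rightarrow> (g x t)\<^sup>2))"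
      by (intro AE_I2) (auto split: split_indicator)
  qed
qed

text \<open>For almost every \<open>x\<close> the product rule in time gives the increment of the
  square of \<open>w x\<close>; Fubini then integrates over \<open>x\<close>. The result is stated
  as an integral over space-time so that the order can be reversed later.\<close>

lemma energy_increment:
  fixes w wt :: "real \<Rightarrow> real \<Rightarrow> real"
  assumes ab: "a \<le> b" and w: "continuous_on ({0..L} \<times> {a..b}) (\<lambda>(x, t). w x t)"
    and wt: "set_integrable lborel ({0..L} \<times> {a..b}) (\<lambda>(x, t). wt x t)"
    and ac: "AE x in lborel. x \<in> {0..L} \<longrightarrow> ac_derivative_on (w x) (wt x) {a..b}"
  defines "h \<equiv> \<lambda>(x, t). indicator ({0..L} \<times> {a..b}) (x, t) * (2 * w x t * wt x t)"
  shows "integrable lborel h"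
    and "integral\<^sup>L lborel h = integral {0..L} (\<lambda>x. (w x b)\<^sup>2) - integral {0..L} (\<lambda>x. (w x a)\<^sup>2)"
proof -
  let ?Q = "{0..L} \<times> {a..b}"
  have Q: "compact ?Q" by (intro compact_Times compact_Icc)
  have cont: "continuous_on {0..L} (\<lambda>x. w x t)" if "t \<in> {a..b}" for t
    by (rule continuous_on_compose2[OF w, of _ "\<lambda>x. (x, t)", simplified])
       (use that in \<open>auto intro!: continuous_intros\<close>)
  have meas_w: "(\<lambda>z. indicator ?Q z *\<^sub>R (case z of (x, t) \<Rightarrow> w x t)) \<in> borel_measurable borel"
    using w Q by (intro borel_measurable_continuous_on_indicator) (auto dest: compact_imp_closed)
  have int_wt: "integrable lborel (\<lambda>z. indicator ?Q z *\<^sub>R (case z of (x, t) \<Rightarrow> wt x t))"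
    using wt by (simp add: set_integrable_def)
  have h_eq: "h = (\<lambda>z. 2 * (indicator ?Q z *\<^sub>R (case z of (x, t) \<Rightarrow> w x t)) *
      (indicator ?Q z *\<^sub>R (case z of (x, t) \<Rightarrow> wt x t)))"
    by (auto simp: h_def indicator_def)
  have meas_h: "h \<in> borel_measurable lborel"
    unfolding h_eq using meas_w borel_measurable_integrable[OF int_wt]
    by (intro borel_measurable_times) (simp_all add: measurable_lborel2)
  \<comment> \<open>Boundedness of \<open>w\<close> on the compact rectangle makes the product with
    the merely integrable \<open>wt\<close> integrable.\<close>
  obtain K where K: "\<And>x t. (x, t) \<in> ?Q \<Longrightarrow> \<bar>w x t\<bar> \<le> K"
    using compact_imp_bounded[OF compact_continuous_image[OF w Q]]
    unfolding bounded_iff by force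
  show int: "integrable lborel h"
  proof (rule Bochner_Integration.integrable_bound[OF _ meas_h])
    show "integrable lborel (\<lambda>z. 2 * K * (indicator ?Q z *\<^sub>R (case z of (x, t) \<Rightarrow> wt x t)))"
      using int_wt by (rule integrable_mult_right)
    show "AE z in lborel. norm (h z) \<le> norm (2 * K * (indicator ?Q z *\<^sub>R (case z of (x, t) \<Rightarrow> wt x t)))"
    proof (intro AE_I2, clarify)
      fix x t
      have "\<bar>w x t\<bar> * \<bar>wt x t\<bar> \<le> \<bar>K\<bar> * \<bar>wt x t\<bar>" if "(x, t) \<in> ?Q"
        using K[OF that] by (intro mult_right_mono) auto
      thus "norm (h (x, t)) \<le> norm (2 * K * (indicator ?Q (x, t) *\<^sub>R wt x t))"
        by (auto simp: h_def abs_mult indicator_def)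
    qed
  qed
  have int2: "integrable (lborel \<Otimes>\<^sub>M lborel) h" using int by (simp add: lborel_prod)
  have "integral\<^sup>L lborel h = (\<integral>x. (\<integral>t. h (x, t) \<partial>lborel) \<partial>lborel)"
    using lborel_pair.integral_fst'[OF int2] by (simp add: lborel_prod)
  also have "\<dots> = (\<integral>x. indicator {0..L} x *\<^sub>R ((w x b)\<^sup>2 - (w x a)\<^sup>2) \<partial>lborel)"
  proof (rule integral_cong_AE)
    show "(\<lambda>x. \<integral>t. h (x, t) \<partial>lborel) \<in> borel_measurable lborel"
      by (rule borel_measurable_integrable[OF lborel_pair.integrable_fst'[OF int2]])
    show "(\<lambda>x. indicator {0..L} x *\<^sub>R ((w x b)\<^sup>2 - (w x a)\<^sup>2)) \<in> borel_measurable lborel"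
      using ab unfolding measurable_lborel2
      by (intro borel_measurable_continuous_on_indicator continuous_intros cont) auto
    show "AE x in lborel. (\<integral>t. h (x, t) \<partial>lborel) = indicator {0..L} x *\<^sub>R ((w x b)\<^sup>2 - (w x a)\<^sup>2)"
      using ac lborel_pair.AE_integrable_fst'[OF int2]
    proof eventually_elim
      case (elim x)
      show ?case
      proof (cases "x \<in> {0..L}")
        case True
        note ac = elim(1)[rule_format, OF True]
        have "(\<integral>t. h (x, t) \<partial>lborel) = integral {a..b} (\<lambda>t. wt x t * w x t + w x t * wt x t)"
          by (rule integral_lborel_version[OF elim(2) _ ac_derivative_on_mult_Icc(1)[OF ac ac ab]])
             (use True in \<open>auto simp: h_def indicator_def algebra_simps\<close>)
        also have "\<dots> = (w x b)\<^sup>2 - (w x a)\<^sup>2"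
          by (simp only: ac_derivative_on_mult_Icc(2)[OF ac ac ab] power2_eq_square)
        finally show ?thesis using True by simp
      qed (simp add: h_def indicator_times)
    qed
  qed
  also have "\<dots> = (LINT x:{0..L}|lborel. (w x b)\<^sup>2 - (w x a)\<^sup>2)"
    by (simp add: set_lebesgue_integral_def)
  also have "\<dots> = integral {0..L} (\<lambda>x. (w x b)\<^sup>2 - (w x a)\<^sup>2)"
    by (intro set_borel_integral_eq_integral(2) borel_integrable_atLeastAtMost' continuous_intros cont)
       (use ab in auto)
  also have "\<dots> = integral {0..L} (\<lambda>x. (w x b)\<^sup>2) - integral {0..L} (\<lambda>x. (w x a)\<^sup>2)"
    by (intro Henstock_Kurzweil_Integration.integral_diff integrable_continuous_interval continuous_intros cont)
       (use ab in auto)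
  finally show "integral\<^sup>L lborel h = integral {0..L} (\<lambda>x. (w x b)\<^sup>2) - integral {0..L} (\<lambda>x. (w x a)\<^sup>2)" .
qed

section \<open>Dissipation at a fixed time\<close>

lemma lambda2_energy_le:
  fixes M :: "real ^ 'n ^ 'n" and v :: "'n \<Rightarrow> real \<Rightarrow> real"
  assumes M: "adjacency_matrix M" "undirected M"
    and cont: "\<And>i. continuous_on {0..L} (v i)"
  shows "2 * lambda2 (laplacian M) * (\<Sum>i\<in>UNIV. integral {0..L} (\<lambda>x. (deviation (\<lambda>j. v j x) i)\<^sup>2))
    \<le> (\<Sum>(i, j)\<in>UNIV. M $ i $ j * integral {0..L} (\<lambda>x. (v i x - v j x)\<^sup>2))"
proof -
  have int1: "(\<lambda>x. (deviation (\<lambda>j. v j x) i)\<^sup>2) integrable_on {0..L}" for i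
    unfolding deviation_def by (intro integrable_continuous_interval continuous_intros cont) auto
  have int2: "(\<lambda>x. (v i x - v j x)\<^sup>2) integrable_on {0..L}" for i j
    by (intro integrable_continuous_interval continuous_intros cont)
  have "2 * lambda2 (laplacian M) * (\<Sum>i\<in>UNIV. integral {0..L} (\<lambda>x. (deviation (\<lambda>j. v j x) i)\<^sup>2))
    = integral {0..L} (\<lambda>x. 2 * lambda2 (laplacian M) * (\<Sum>i\<in>UNIV. (deviation (\<lambda>j. v j x) i)\<^sup>2))"
    by (simp add: Henstock_Kurzweil_Integration.integral_sum int1)
  also have "\<dots> \<le> integral {0..L} (\<lambda>x. \<Sum>i\<in>UNIV. \<Sum>j\<in>UNIV. M $ i $ j * (v i x - v j x)\<^sup>2)"
    using int1 int2
    by (intro integral_le lambda2_deviation_le M integrable_sum integrable_on_mult_right) auto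
  also have "\<dots> = (\<Sum>i\<in>UNIV. \<Sum>j\<in>UNIV. M $ i $ j * integral {0..L} (\<lambda>x. (v i x - v j x)\<^sup>2))"
    by (simp add: Henstock_Kurzweil_Integration.integral_sum integrable_sum integrable_on_mult_right int2)
  finally show ?thesis by (simp add: sum.cartesian_product)
qed

text \<open>The two power inequalities are applied to the squared distances \<open>w i j\<close>,
  indexed by ordered pairs of agents. The weighted sums inside the powers are then bounded below by
  \<open>lambda2_energy_le\<close> for \<open>B\<close> and \<open>P\<close>.\<close>

lemma power_dissipation_ge:
  fixes A :: "real ^ 'n ^ 'n" and v :: "'n \<Rightarrow> real \<Rightarrow> real"
  assumes par: "0 < \<alpha>" "\<alpha> < 1" "\<beta> > 1" and A: "adjacency_matrix A" "undirected A"
    and cont: "\<And>i. continuous_on {0..L} (v i)"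
  defines "w \<equiv> \<lambda>i j. integral {0..L} (\<lambda>x. (v i x - v j x)\<^sup>2)"
    and "W \<equiv> (\<Sum>i\<in>UNIV. integral {0..L} (\<lambda>x. (deviation (\<lambda>j. v j x) i)\<^sup>2))"
    and "B \<equiv> (\<chi> i j. (A $ i $ j) powr (1 / \<alpha>)) :: real ^ 'n ^ 'n"
    and "P \<equiv> (\<chi> i j. (A $ i $ j) powr (1 / \<beta>)) :: real ^ 'n ^ 'n"
  assumes lam: "0 \<le> lambda2 (laplacian B)" "0 \<le> lambda2 (laplacian P)"
  shows "(2 * lambda2 (laplacian B)) powr \<alpha> * W powr \<alpha>
      + (real CARD('n) powr (1 - \<beta>))\<^sup>2 * (2 * lambda2 (laplacian P)) powr \<beta> * W powr \<beta>
    \<le> (\<Sum>i\<in>UNIV. \<Sum>j\<in>UNIV. A $ i $ j * (w i j powr (\<alpha> - 1) + w i j powr (\<beta> - 1)) * w i j)"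
proof -
  have BP: "adjacency_matrix B" "undirected B" "adjacency_matrix P" "undirected P"
    using A(2) by (auto simp: B_def P_def adjacency_matrix_def undirected_def)
  have a0: "0 \<le> A $ i $ j" for i j using A(1) by (simp add: adjacency_matrix_def)
  have w0: "0 \<le> w i j" for i j
    unfolding w_def
    by (intro Henstock_Kurzweil_Integration.integral_nonneg integrable_continuous_interval
        continuous_intros cont) auto
  have W0: "0 \<le> W"
    unfolding W_def deviation_def
    by (intro sum_nonneg Henstock_Kurzweil_Integration.integral_nonneg integrable_continuous_interval
        continuous_intros cont) auto
  have "(2 * lambda2 (laplacian B)) powr \<alpha> * W powr \<alpha> = (2 * lambda2 (laplacian B) * W) powr \<alpha>"
    using lam W0 by (simp add: powr_mult)
  also have "\<dots> \<le> (\<Sum>(i, j)\<in>UNIV. B $ i $ j * w i j) powr \<alpha>"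
    unfolding W_def w_def using lam W0[unfolded W_def] par
    by (intro powr_mono2 lambda2_energy_le BP cont) auto
  also have "\<dots> \<le> (\<Sum>(i, j)\<in>UNIV. A $ i $ j * w i j powr \<alpha>)"
    using sum_mult_powr_concave[of \<alpha> "UNIV :: ('n \<times> 'n) set" "\<lambda>(i, j). A $ i $ j" "\<lambda>(i, j). w i j"] par a0 w0
    by (simp add: B_def case_prod_beta)
  finally have 1: "(2 * lambda2 (laplacian B)) powr \<alpha> * W powr \<alpha> \<le> (\<Sum>(i, j)\<in>UNIV. A $ i $ j * w i j powr \<alpha>)" .
  \<comment> \<open>There are \<open>CARD('n)\<close> squared ordered pairs, whence the square of
    the power mean constant.\<close>
  have N: "(real CARD('n) powr (1 - \<beta>))\<^sup>2 = real (card (UNIV :: ('n \<times> 'n) set)) powr (1 - \<beta>)"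
    by (simp add: power2_eq_square powr_mult flip: UNIV_Times_UNIV)
  have "(2 * lambda2 (laplacian P)) powr \<beta> * W powr \<beta> = (2 * lambda2 (laplacian P) * W) powr \<beta>"
    using lam W0 by (simp add: powr_mult)
  also have "\<dots> \<le> (\<Sum>(i, j)\<in>UNIV. P $ i $ j * w i j) powr \<beta>"
    unfolding W_def w_def using lam W0[unfolded W_def] par
    by (intro powr_mono2 lambda2_energy_le BP cont) auto
  finally have "(real CARD('n) powr (1 - \<beta>))\<^sup>2 * ((2 * lambda2 (laplacian P)) powr \<beta> * W powr \<beta>)
      \<le> (real CARD('n) powr (1 - \<beta>))\<^sup>2 * (\<Sum>(i, j)\<in>UNIV. P $ i $ j * w i j) powr \<beta>"
    by (intro mult_left_mono) auto
  also have "\<dots> \<le> (\<Sum>(i, j)\<in>UNIV. A $ i $ j * w i j powr \<beta>)"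
    using sum_mult_powr_convex[of \<beta> "UNIV :: ('n \<times> 'n) set" "\<lambda>(i, j). A $ i $ j" "\<lambda>(i, j). w i j"] par a0 w0
    unfolding N by (simp add: P_def case_prod_beta)
  finally have 2: "(real CARD('n) powr (1 - \<beta>))\<^sup>2 * (2 * lambda2 (laplacian P)) powr \<beta> * W powr \<beta>
      \<le> (\<Sum>(i, j)\<in>UNIV. A $ i $ j * w i j powr \<beta>)" by (simp add: mult.assoc)
  \<comment> \<open>For coinciding agents both sides are 0 because \<open>0 powr p = 0\<close>, in
    accordance with the reading of the controller.\<close>
  have wp: "w i j powr p = w i j powr (p - 1) * w i j" for i j p
    using powr_mult_base[OF w0[of i j], of "p - 1"] by (simp add: mult.commute)
  have "(\<Sum>i\<in>UNIV. \<Sum>j\<in>UNIV. A $ i $ j * (w i j powr (\<alpha> - 1) + w i j powr (\<beta> - 1)) * w i j)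
      = (\<Sum>(i, j)\<in>UNIV. A $ i $ j * w i j powr \<alpha>) + (\<Sum>(i, j)\<in>UNIV. A $ i $ j * w i j powr \<beta>)"
    unfolding sum.distrib[symmetric] UNIV_Times_UNIV[symmetric] sum.cartesian_product
    by (intro sum.cong refl) (simp add: case_prod_beta wp[of _ _ \<alpha>] wp[of _ _ \<beta>] algebra_simps)
  with 1 2 show ?thesis by linarith
qed

text \<open>The pointwise estimate is integrated over space at one time \<open>t\<close>. The
  deviations inherit the boundary values 0, so the diffusion contributes a nonpositive amount and is
  dropped.\<close>

lemma consensus_energy_rate:
  fixes A :: "real ^ 'n ^ 'n" and y :: "'n \<Rightarrow> real \<Rightarrow> real \<Rightarrow> real"
  assumes A: "adjacency_matrix A" "undirected A" and L: "0 \<le> L" and k: "0 \<le> k"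
    and E: "E = (\<chi> i j. (A $ i $ j)\<^sup>2)" and lam: "0 < lambda2 (laplacian E)"
    and \<delta>: "\<And>i x. x \<in> {0..L} \<Longrightarrow> \<bar>\<delta> i x\<bar> \<le> dmax"
    and dbar: "2 * dmax * real CARD('n) powr (1 / 2) / (sqrt 2 * lambda2 (laplacian E) powr (1 / 2)) \<le> dbar"
    and yx: "\<And>i. ac_derivative_on (\<lambda>x. y i x t) (yx i) {0..L}"
    and yxx: "\<And>i. ac_derivative_on (yx i) (yxx i) {0..L}"
    and bc: "\<And>i. y i 0 t = 0" "\<And>i. y i L t = 0"
    and pde: "AE x in lborel. x \<in> {0..L} \<longrightarrow> (\<exists>\<sigma>. admissible_signs (\<lambda>i. y i x t) \<sigma> \<and>
      (\<forall>i. yt i x = k * yxx i x + control A L \<alpha> \<beta> dbar y \<sigma> i x t + \<delta> i x))"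
    and int: "(\<lambda>x. 2 * (\<Sum>i\<in>UNIV. deviation (\<lambda>j. y j x t) i * yt i x)) absolutely_integrable_on {0..L}"
  defines "w \<equiv> \<lambda>i j. integral {0..L} (\<lambda>z. (y i z t - y j z t)\<^sup>2)"
  shows "integral {0..L} (\<lambda>x. 2 * (\<Sum>i\<in>UNIV. deviation (\<lambda>j. y j x t) i * yt i x))
    \<le> - (\<Sum>i\<in>UNIV. \<Sum>j\<in>UNIV. A $ i $ j * (w i j powr (\<alpha> - 1) + w i j powr (\<beta> - 1)) * w i j)"
proof -
  define D where "D i x = deviation (\<lambda>j. y j x t) i" for i x
  define Dxx where "Dxx i x = deviation (\<lambda>j. yxx j x) i" for i x
  define c where "c i j = A $ i $ j * (w i j powr (\<alpha> - 1) + w i j powr (\<beta> - 1))" for i j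
  define r1 where "r1 x = 2 * k * (\<Sum>i\<in>UNIV. D i x * Dxx i x)" for x
  define r2 where "r2 x = (\<Sum>i\<in>UNIV. \<Sum>j\<in>UNIV. c i j * (y i x t - y j x t)\<^sup>2)" for x
  have cont: "continuous_on {0..L} (\<lambda>x. y i x t)" for i
    by (rule ac_derivative_on_continuous_on[OF yx])
  have D0: "D i 0 = 0" "D i L = 0" for i by (simp_all add: D_def deviation_def bc)
  have ac: "ac_derivative_on (D i) (\<lambda>x. deviation (\<lambda>j. yx j x) i) {0..L}"
    "ac_derivative_on (\<lambda>x. deviation (\<lambda>j. yx j x) i) (Dxx i) {0..L}" for i
    unfolding D_def[abs_def] Dxx_def[abs_def] by (intro ac_derivative_on_deviation yx yxx)+
  note energy = ac_derivative_on_energy_nonpos[OF ac D0 L]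
  have int_w: "(\<lambda>x. (y i x t - y j x t)\<^sup>2) absolutely_integrable_on {0..L}" for i j
    by (intro absolutely_integrable_continuous_real continuous_intros cont)
  have int1: "r1 absolutely_integrable_on {0..L}"
    unfolding r1_def[abs_def]
    by (intro set_integrable_mult_right absolutely_integrable_sum) (auto intro: energy(1))
  have int2: "r2 absolutely_integrable_on {0..L}"
    unfolding r2_def[abs_def]
    by (intro set_integrable_mult_right absolutely_integrable_sum int_w) auto
  note hk = set_lebesgue_integral_eq_integral(1)
  have pointwise: "AE x\<in>{0..L} in lebesgue. 2 * (\<Sum>i\<in>UNIV. D i x * yt i x) \<le> r1 x - r2 x"
  proof (rule AE_completion, use pde in eventually_elim, intro impI)
    fix x
    assume "x \<in> {0..L} \<longrightarrow> (\<exists>\<sigma>. admissible_signs (\<lambda>i. y i x t) \<sigma> \<and>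
      (\<forall>i. yt i x = k * yxx i x + control A L \<alpha> \<beta> dbar y \<sigma> i x t + \<delta> i x))" and x: "x \<in> {0..L}"
    then obtain \<sigma> where \<sigma>: "admissible_signs (\<lambda>i. y i x t) \<sigma>"
      and eq: "\<And>i. yt i x = k * yxx i x + control A L \<alpha> \<beta> dbar y \<sigma> i x t + \<delta> i x" by blast
    \<comment> \<open>The deviations add up to 0, so subtracting the mean from the second factor
      changes nothing.\<close>
    have "(\<Sum>i\<in>UNIV. D i x * Dxx i x) = (\<Sum>i\<in>UNIV. D i x * yxx i x)"
      using sum_deviation[of "\<lambda>j. y j x t"]
      by (simp add: D_def Dxx_def deviation_def[of "\<lambda>j. yxx j x"] right_diff_distrib sum_subtractf
          flip: sum_distrib_right sum_divide_distrib times_divide_eq_right)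
    thus "2 * (\<Sum>i\<in>UNIV. D i x * yt i x) \<le> r1 x - r2 x"
      using sum_deviation_closed_loop_le[OF A E lam \<delta>[OF x] dbar \<sigma> eq]
      by (simp add: D_def r1_def r2_def c_def w_def)
  qed
  have "integral {0..L} (\<lambda>x. 2 * (\<Sum>i\<in>UNIV. D i x * yt i x)) \<le> integral {0..L} (\<lambda>x. r1 x - r2 x)"
    using set_integral_mono_AE[OF int[folded D_def] set_integral_diff(1)[OF int1 int2] pointwise]
    unfolding set_lebesgue_integral_eq_integral(2)[OF int[folded D_def]]
      set_lebesgue_integral_eq_integral(2)[OF set_integral_diff(1)[OF int1 int2]] .
  also have "\<dots> = integral {0..L} r1 - integral {0..L} r2"
    by (intro Henstock_Kurzweil_Integration.integral_diff hk int1 int2)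
  also have "integral {0..L} r1 = 2 * k * (\<Sum>i\<in>UNIV. integral {0..L} (\<lambda>x. D i x * Dxx i x))"
    unfolding r1_def[abs_def]
    by (simp add: Henstock_Kurzweil_Integration.integral_sum hk energy(1))
  also have "\<dots> \<le> 0"
    using k by (intro mult_nonneg_nonpos sum_nonpos) (auto intro: energy(2))
  also have "integral {0..L} r2 = (\<Sum>i\<in>UNIV. \<Sum>j\<in>UNIV. c i j * w i j)"
    unfolding r2_def[abs_def] w_def
    by (simp add: Henstock_Kurzweil_Integration.integral_sum integrable_sum integrable_on_mult_right hk[OF int_w])
  finally show ?thesis by (simp add: D_def c_def)
qed

section \<open>Decay of the energy in time\<close>

lemma consensus_energy_continuous:
  fixes y :: "'n::finite \<Rightarrow> real \<Rightarrow> real \<Rightarrow> real"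
  assumes "\<And>i. continuous_on ({0..L} \<times> T) (\<lambda>(x, t). y i x t)"
  shows "continuous_on T (\<lambda>t. \<Sum>i\<in>UNIV. integral {0..L} (\<lambda>x. (deviation (\<lambda>j. y j x t) i)\<^sup>2))"
proof (rule continuous_on_sum)
  fix i
  have "continuous_on (T \<times> {0..L}) (\<lambda>p. y j (snd p) (fst p))" for j
    by (rule continuous_on_compose2[OF assms[of j], of _ "\<lambda>p. (snd p, fst p)", simplified])
       (auto intro!: continuous_intros)
  hence "continuous_on (T \<times> cbox 0 L) (\<lambda>(t, x). (deviation (\<lambda>j. y j x t) i)\<^sup>2)"
    unfolding deviation_def case_prod_beta' by (intro continuous_intros) auto
  from integral_continuous_on_param[OF this]
  show "continuous_on T (\<lambda>t. integral {0..L} (\<lambda>x. (deviation (\<lambda>j. y j x t) i)\<^sup>2))" by simp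
qed

lemma consensus_energy_nonneg:
  fixes v :: "'n::finite \<Rightarrow> real \<Rightarrow> real"
  shows "0 \<le> (\<Sum>i\<in>UNIV. integral {0..L} (\<lambda>x. (deviation (\<lambda>j. v j x) i)\<^sup>2))"
proof (rule sum_nonneg)
  fix i
  let ?f = "\<lambda>x. (deviation (\<lambda>j. v j x) i)\<^sup>2"
  \<comment> \<open>A function that is not integrable has \<open>integral\<close> 0 by
    convention.\<close>
  show "0 \<le> integral {0..L} ?f"
    by (cases "?f integrable_on {0..L}")
       (auto intro: Henstock_Kurzweil_Integration.integral_nonneg simp: not_integrable_integral)
qed

text \<open>The increment of \<open>W\<close> is an integral of \<open>H\<close> over space-time.
  Fubini moves time outermost, and for almost every \<open>t\<close> the inner integral over space
  is at most \<open>- F t\<close> by the estimates at a fixed time. The start \<open>a\<close> is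
  positive because the regularity is only available there.\<close>

lemma closed_loop_energy_decay:
  fixes A :: "real ^ 'n ^ 'n" and d :: "'n \<Rightarrow> real \<Rightarrow> real \<Rightarrow> real"
    and y yt yxx :: "'n \<Rightarrow> real \<Rightarrow> real \<Rightarrow> real"
  assumes par: "0 < \<alpha>" "\<alpha> < 1" "\<beta> > 1" "L > 0" "k > 0"
    and A: "adjacency_matrix A" "undirected A"
    and dist: "\<And>i x t. x \<in> {0..L} \<Longrightarrow> t \<ge> 0 \<Longrightarrow> \<bar>d i x t\<bar> \<le> dmax"
  defines "E \<equiv> (\<chi> i j. (A $ i $ j)\<^sup>2) :: real ^ 'n ^ 'n"
    and "B \<equiv> (\<chi> i j. (A $ i $ j) powr (1 / \<alpha>)) :: real ^ 'n ^ 'n"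
    and "P \<equiv> (\<chi> i j. (A $ i $ j) powr (1 / \<beta>)) :: real ^ 'n ^ 'n"
  assumes lam: "0 < lambda2 (laplacian E)" "0 \<le> lambda2 (laplacian B)" "0 \<le> lambda2 (laplacian P)"
    and dbar: "2 * dmax * real CARD('n) powr (1 / 2) / (sqrt 2 * lambda2 (laplacian E) powr (1 / 2)) \<le> dbar"
    and sd: "\<And>i. strong_derivatives L (y i) (yt i) (yxx i)"
    and pde: "AE (x, t) in lborel. x \<in> {0..L} \<and> t > 0 \<longrightarrow>
           (\<exists>\<sigma>. admissible_signs (\<lambda>i. y i x t) \<sigma> \<and>
                (\<forall>i. yt i x t = k * yxx i x t + control A L \<alpha> \<beta> dbar y \<sigma> i x t + d i x t))"
    and bc: "\<And>i t. t > 0 \<Longrightarrow> y i 0 t = 0" "\<And>i t. t > 0 \<Longrightarrow> y i L t = 0"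
    and ab: "0 < a" "a \<le> b"
  defines "W \<equiv> \<lambda>t. \<Sum>i\<in>UNIV. integral {0..L} (\<lambda>x. (deviation (\<lambda>j. y j x t) i)\<^sup>2)"
  shows "W b - W a \<le> - integral {a..b} (\<lambda>t. (2 * lambda2 (laplacian B)) powr \<alpha> * W t powr \<alpha>
      + (real CARD('n) powr (1 - \<beta>))\<^sup>2 * (2 * lambda2 (laplacian P)) powr \<beta> * W t powr \<beta>)"
proof -
  define Q where "Q = {0..L} \<times> {a..b}"
  define F where "F t = (2 * lambda2 (laplacian B)) powr \<alpha> * W t powr \<alpha>
      + (real CARD('n) powr (1 - \<beta>))\<^sup>2 * (2 * lambda2 (laplacian P)) powr \<beta> * W t powr \<beta>" for t
  define h where "h i = (\<lambda>(x, t). indicator Q (x, t) *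
      (2 * deviation (\<lambda>j. y j x t) i * deviation (\<lambda>j. yt j x t) i))" for i
  have y_cont: "continuous_on ({0..L} \<times> {0<..}) (\<lambda>(x, t). y i x t)" for i
    using sd by (simp add: strong_derivatives_def)
  have "continuous_on Q (\<lambda>(x, t). y i x t)" for i
    by (rule continuous_on_subset[OF y_cont]) (use ab in \<open>auto simp: Q_def\<close>)
  hence D_cont: "continuous_on Q (\<lambda>(x, t). deviation (\<lambda>j. y j x t) i)" for i
    unfolding deviation_def case_prod_beta' by (intro continuous_intros) auto
  have yt_int: "set_integrable lborel Q (\<lambda>(x, t). yt i x t)" for i
    unfolding Q_def using sd ab
    by (intro locally_square_integrable_imp_set_integrable) (auto simp: strong_derivatives_def)
  have Dt_int: "set_integrable lborel Q (\<lambda>(x, t). deviation (\<lambda>j. yt j x t) i)" for i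
  proof -
    have eq: "(\<lambda>z. indicator Q z *\<^sub>R (case z of (x, t) \<Rightarrow> deviation (\<lambda>j. yt j x t) i))
      = (\<lambda>z. indicator Q z *\<^sub>R (case z of (x, t) \<Rightarrow> yt i x t)
          - (\<Sum>j\<in>UNIV. indicator Q z *\<^sub>R (case z of (x, t) \<Rightarrow> yt j x t)) / real CARD('n))"
      by (auto simp: deviation_def indicator_def)
    thus ?thesis
      using yt_int unfolding set_integrable_def eq
      by (intro Bochner_Integration.integrable_diff integrable_divide_zero Bochner_Integration.integrable_sum) auto
  qed
  have "AE x in lborel. \<forall>i\<in>UNIV. x \<in> {0..L} \<longrightarrow> ac_derivative_on (y i x) (yt i x) {0<..}"
    using sd by (intro AE_finite_allI) (auto simp: strong_derivatives_def)
  hence D_ac: "AE x in lborel. x \<in> {0..L} \<longrightarrow>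
      ac_derivative_on (\<lambda>t. deviation (\<lambda>j. y j x t) i) (\<lambda>t. deviation (\<lambda>j. yt j x t) i) {a..b}" for i
  proof eventually_elim
    case (elim x)
    show ?case
    proof
      assume "x \<in> {0..L}"
      hence "ac_derivative_on (y j x) (yt j x) {0<..}" for j using elim by blast
      hence "ac_derivative_on (y j x) (yt j x) {a..b}" for j
        by (rule ac_derivative_on_subset) (use ab in auto)
      thus "ac_derivative_on (\<lambda>t. deviation (\<lambda>j. y j x t) i) (\<lambda>t. deviation (\<lambda>j. yt j x t) i) {a..b}"
        by (rule ac_derivative_on_deviation)
    qed
  qed
  have inc: "integrable lborel (h i)"
    "integral\<^sup>L lborel (h i) = integral {0..L} (\<lambda>x. (deviation (\<lambda>j. y j x b) i)\<^sup>2)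
        - integral {0..L} (\<lambda>x. (deviation (\<lambda>j. y j x a) i)\<^sup>2)" for i
    unfolding h_def Q_def
    by (rule energy_increment[OF ab(2) D_cont[unfolded Q_def] Dt_int[unfolded Q_def] D_ac])+
  define H where "H x t = (\<Sum>i\<in>UNIV. h i (x, t))" for x t
  have H_int: "integrable (lborel \<Otimes>\<^sub>M lborel) (\<lambda>(x, t). H x t)"
    unfolding H_def lborel_prod case_prod_beta' prod.collapse
    by (intro Bochner_Integration.integrable_sum inc(1))
  \<comment> \<open>The mean of the time derivatives drops out against deviations of sum 0, which
    brings the integrand into the form of \<open>consensus_energy_rate\<close>.\<close>
  have H_eq: "H x t = indicator {0..L} x * (2 * (\<Sum>i\<in>UNIV. deviation (\<lambda>j. y j x t) i * yt i x t))"
    if "t \<in> {a..b}" for x t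
  proof -
    have "(\<Sum>i\<in>UNIV. deviation (\<lambda>j. y j x t) i * deviation (\<lambda>j. yt j x t) i)
      = (\<Sum>i\<in>UNIV. deviation (\<lambda>j. y j x t) i * yt i x t)"
      using sum_deviation[of "\<lambda>j. y j x t"]
      by (simp add: deviation_def[of "\<lambda>j. yt j x t"] right_diff_distrib sum_subtractf
          flip: sum_distrib_right sum_divide_distrib times_divide_eq_right)
    thus ?thesis
      using that by (simp add: H_def h_def Q_def indicator_times sum_distrib_left mult.assoc flip: sum_distrib_left)
  qed
  have rate: "AE t in lborel. (\<integral>x. H x t \<partial>lborel) \<le> indicator {a..b} t *\<^sub>R (- F t)"
  proof -
    have 1: "AE t in lborel. \<forall>i\<in>UNIV. t > 0 \<longrightarrow> (\<exists>wx. ac_derivative_on (\<lambda>x. y i x t) wx {0..L} \<and>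
        ac_derivative_on wx (\<lambda>x. yxx i x t) {0..L})"
      using sd by (intro AE_finite_allI) (auto simp: strong_derivatives_def)
    have 2: "AE t in lborel. AE x in lborel. x \<in> {0..L} \<and> t > 0 \<longrightarrow>
           (\<exists>\<sigma>. admissible_signs (\<lambda>i. y i x t) \<sigma> \<and>
                (\<forall>i. yt i x t = k * yxx i x t + control A L \<alpha> \<beta> dbar y \<sigma> i x t + d i x t))"
      by (rule AE_lborel_pair_swap) (use pde in \<open>simp add: case_prod_beta'\<close>)
    show ?thesis
      using 1 2 lborel_pair.AE_integrable_snd[OF H_int]
    proof eventually_elim
      case (elim t)
      show ?case
      proof (cases "t \<in> {a..b}")
        case False
        hence "H x t = 0" for x by (simp add: H_def h_def Q_def indicator_times)
        thus ?thesis using False by simp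
      next
        case True
        hence t: "t > 0" using ab by auto
        let ?g = "\<lambda>x. 2 * (\<Sum>i\<in>UNIV. deviation (\<lambda>j. y j x t) i * yt i x t)"
        have "\<forall>i. \<exists>wx. ac_derivative_on (\<lambda>x. y i x t) wx {0..L} \<and>
            ac_derivative_on wx (\<lambda>x. yxx i x t) {0..L}"
          using elim(1) t by blast
        then obtain yx where yx: "\<And>i. ac_derivative_on (\<lambda>x. y i x t) (yx i) {0..L}"
            "\<And>i. ac_derivative_on (yx i) (\<lambda>x. yxx i x t) {0..L}"
          by metis
        have g_lborel: "set_integrable lborel {0..L} ?g"
          using elim(3) by (simp add: set_integrable_def H_eq[OF True])
        hence g_int: "?g absolutely_integrable_on {0..L}"
          by (simp add: set_integrable_def integrable_completion)
        have pde_t: "AE x in lborel. x \<in> {0..L} \<longrightarrow> (\<exists>\<sigma>. admissible_signs (\<lambda>i. y i x t) \<sigma> \<and>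
          (\<forall>i. yt i x t = k * yxx i x t + control A L \<alpha> \<beta> dbar y \<sigma> i x t + d i x t))"
          using elim(2) t by simp
        have dist_t: "\<bar>d i x t\<bar> \<le> dmax" if "x \<in> {0..L}" for i x
          using dist[OF that] t by simp
        have cont: "continuous_on {0..L} (\<lambda>x. y i x t)" for i
          by (rule ac_derivative_on_continuous_on[OF yx(1)])
        have "(\<integral>x. H x t \<partial>lborel) = integral {0..L} ?g"
          using set_borel_integral_eq_integral(2)[OF g_lborel]
          by (simp only: set_lebesgue_integral_def H_eq[OF True] real_scaleR_def)
        also have "\<dots> \<le> - F t"
          using consensus_energy_rate[OF A less_imp_le[OF par(4)] less_imp_le[OF par(5)]
              E_def[THEN meta_eq_to_obj_eq] lam(1) dist_t dbar yx
              bc(1)[OF t] bc(2)[OF t] pde_t g_int]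
            power_dissipation_ge[where v = "\<lambda>i x. y i x t", OF par(1-3) A cont lam(2,3)[unfolded B_def P_def]]
          unfolding F_def W_def B_def P_def by linarith
        finally show ?thesis using True by simp
      qed
    qed
  qed
  have W_cont: "continuous_on {a..b} W"
    unfolding W_def by (rule continuous_on_subset[OF consensus_energy_continuous[OF y_cont]]) (use ab in auto)
  have W_nonneg: "0 \<le> W t" for t
    unfolding W_def by (rule consensus_energy_nonneg)
  have powr_cont: "continuous_on {a..b} (\<lambda>t. W t powr p)" if "0 < p" for p
    by (rule continuous_on_powr'[OF W_cont continuous_on_const]) (use W_nonneg that in blast)
  have F_cont: "continuous_on {a..b} F"
    unfolding F_def using par by (intro continuous_on_add continuous_on_mult continuous_on_const powr_cont) auto
  have "W b - W a = (\<Sum>i\<in>UNIV. integral\<^sup>L lborel (h i))"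
    by (simp add: W_def inc(2) sum_subtractf)
  also have "\<dots> = (\<integral>z. (\<Sum>i\<in>UNIV. h i z) \<partial>lborel)"
    by (rule Bochner_Integration.integral_sum[symmetric]) (rule inc(1))
  also have "\<dots> = (\<integral>t. (\<integral>x. H x t \<partial>lborel) \<partial>lborel)"
    using lborel_pair.integral_snd[OF H_int] by (simp add: H_def lborel_prod case_prod_beta')
  also have "\<dots> \<le> (\<integral>t. indicator {a..b} t *\<^sub>R (- F t) \<partial>lborel)"
  proof (rule integral_mono_AE[OF lborel_pair.integrable_snd[OF H_int] _ rate])
    show "integrable lborel (\<lambda>t. indicator {a..b} t *\<^sub>R (- F t))"
      using borel_integrable_atLeastAtMost'[OF continuous_on_minus[OF F_cont]]
      by (simp add: set_integrable_def)
  qed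
  also have "\<dots> = integral {a..b} (\<lambda>t. - F t)"
    using set_borel_integral_eq_integral(2)[OF borel_integrable_atLeastAtMost'[OF continuous_on_minus[OF F_cont]]]
    by (simp add: set_lebesgue_integral_def)
  finally show ?thesis unfolding Henstock_Kurzweil_Integration.integral_neg F_def .
qed

section \<open>Settling time\<close>

text \<open>The comparison runs backwards from \<open>b\<close>: \<open>R t = W b + \<integral>\<^sub>t\<^sup>b c W\<^sup>p\<close> is a \<open>C\<^sup>1\<close> minorant of \<open>W\<close> with
  \<open>R' \<le> - c R\<^sup>p\<close>, so no differentiability of \<open>W\<close> is needed.\<close>

lemma powr_decay:
  fixes W :: "real \<Rightarrow> real"
  assumes ab: "a \<le> b" and p: "0 < p" "p \<noteq> 1" and c: "0 \<le> c"
    and cont: "continuous_on {a..b} W" and nonneg: "\<And>t. t \<in> {a..b} \<Longrightarrow> 0 \<le> W t"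
    and decr: "\<And>t. t \<in> {a..b} \<Longrightarrow> W b - W t \<le> - integral {t..b} (\<lambda>s. c * W s powr p)"
    and pos: "0 < W b"
  shows "W b powr (1 - p) / (1 - p) + c * (b - a) \<le> W a powr (1 - p) / (1 - p)"
proof -
  define g where "g s = c * W s powr p" for s
  define R where "R t = W b + integral {t..b} g" for t
  define \<psi> where "\<psi> r = r powr (1 - p) / (1 - p)" for r :: real
  have g: "continuous_on {a..b} g"
    unfolding g_def using cont p nonneg by (intro continuous_intros continuous_on_powr') auto
  have R_le: "R t \<le> W t" if "t \<in> {a..b}" for t
    using decr[OF that] unfolding R_def g_def by linarith
  have R_ge: "W b \<le> R t" if "t \<in> {a..b}" for t
  proof -
    have "g integrable_on {t..b}"
      using that by (intro integrable_continuous_interval continuous_on_subset[OF g]) auto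
    hence "0 \<le> integral {t..b} g"
      using c by (intro Henstock_Kurzweil_Integration.integral_nonneg) (simp_all add: g_def)
    thus ?thesis by (simp add: R_def)
  qed
  have R_cont: "continuous_on {a..b} R"
    unfolding R_def using g by (intro continuous_intros indefinite_integral_continuous_1' integrable_continuous_interval)
  \<comment> \<open>The derivative of \<open>\<psi>\<close> is \<open>r powr - p\<close>, so the
    inequality for \<open>R\<close> says that \<open>\<psi> (R t) + c * t\<close> does not
    increase.\<close>
  have "\<psi> (R a) + c * a \<ge> \<psi> (R b) + c * b"
  proof (rule DERIV_nonpos_imp_decreasing_open[OF ab])
    show "continuous_on {a..b} (\<lambda>t. \<psi> (R t) + c * t)"
      unfolding \<psi>_def using R_cont R_ge pos p
      by (intro continuous_intros) fastforce+
    fix t assume t: "a < t" "t < b"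
    hence "(R has_real_derivative - g t) (at t within {a..b})"
      unfolding R_def using integral_has_real_derivative'[OF g, of t]
      by (auto intro!: derivative_eq_intros)
    hence dR: "(R has_real_derivative - g t) (at t)"
      using t by (simp add: at_within_Icc_at)
    have Rt: "0 < R t" "R t \<le> W t" using R_ge[of t] R_le[of t] pos t by auto
    have "((\<lambda>t. \<psi> (R t) + c * t) has_real_derivative - (R t powr - p * g t) + c) (at t)"
      unfolding \<psi>_def using p Rt(1)
      by (auto intro!: derivative_eq_intros dR)
    moreover have "c \<le> R t powr - p * g t"
    proof -
      have "c = R t powr - p * (c * R t powr p)" using Rt by (simp add: powr_minus field_simps)
      also have "\<dots> \<le> R t powr - p * (c * W t powr p)"
        using Rt c p by (intro mult_left_mono powr_mono2) auto
      finally show ?thesis by (simp add: g_def)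
    qed
    ultimately show "\<exists>y. ((\<lambda>t. \<psi> (R t) + c * t) has_real_derivative y) (at t) \<and> y \<le> 0"
      by (intro exI conjI) auto
  qed
  moreover have "\<psi> (R a) \<le> \<psi> (W a)"
  proof -
    have le: "0 < R a" "R a \<le> W a" using R_ge[of a] R_le[of a] pos ab by auto
    \<comment> \<open>\<open>\<psi>\<close> is increasing in both cases: for \<open>p > 1\<close>
      the power decreases, but the denominator is negative.\<close>
    show ?thesis
    proof (cases "p < 1")
      case True
      thus ?thesis using le by (auto simp: \<psi>_def intro!: divide_right_mono powr_mono2)
    next
      case False
      thus ?thesis using le p by (auto simp: \<psi>_def intro!: divide_right_mono_neg powr_mono2')
    qed
  qed
  moreover have "R b = W b" by (simp add: R_def)
  ultimately show ?thesis by (simp add: \<psi>_def right_diff_distrib)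
qed

lemma fixed_settling_time:
  fixes W :: "real \<Rightarrow> real"
  assumes \<alpha>: "0 < \<alpha>" "\<alpha> < 1" and \<beta>: "\<beta> > 1" and c: "0 < c1" "0 < c2"
    and cont: "continuous_on {0<..} W" and nonneg: "\<And>t. 0 < t \<Longrightarrow> 0 \<le> W t"
    and decr: "\<And>a b. 0 < a \<Longrightarrow> a \<le> b \<Longrightarrow>
      W b - W a \<le> - integral {a..b} (\<lambda>s. c1 * W s powr \<alpha> + c2 * W s powr \<beta>)"
  shows "W (1 / (c1 * (1 - \<alpha>)) + 1 / (c2 * (\<beta> - 1))) = 0"
proof -
  define T1 T2 where "T1 = 1 / (c1 * (1 - \<alpha>))" and "T2 = 1 / (c2 * (\<beta> - 1))"
  have T: "0 < T1" "0 < T2" using \<alpha> \<beta> c by (simp_all add: T1_def T2_def)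
  have int: "(\<lambda>s. c * W s powr q) integrable_on {a..b}" if "0 < a" "0 < q" for a b c q
  proof -
    have "continuous_on {a..b} W" using cont by (rule continuous_on_subset) (use that in auto)
    thus ?thesis
      using nonneg that
      by (intro integrable_continuous_interval continuous_intros continuous_on_powr') auto
  qed
  \<comment> \<open>Each summand of the decay rate is nonnegative, so either may be discarded; one
    phase keeps the power \<open>\<beta>\<close>, the other \<open>\<alpha>\<close>.\<close>
  have power_decr: "W b - W a \<le> - integral {a..b} (\<lambda>s. c * W s powr p)"
    if ab: "0 < a" "a \<le> b" and "c = c1 \<and> p = \<alpha> \<or> c = c2 \<and> p = \<beta>" for a b c p
  proof -
    have "integral {a..b} (\<lambda>s. c * W s powr p) \<le> integral {a..b} (\<lambda>s. c1 * W s powr \<alpha> + c2 * W s powr \<beta>)"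
      using that \<alpha> \<beta> assms(4,5)
      by (intro integral_le int integrable_add) auto
    thus ?thesis using decr[OF ab] by linarith
  qed
  have decay: "W b powr (1 - p) / (1 - p) + c * (b - a) \<le> W a powr (1 - p) / (1 - p)"
    if "0 < a" "a \<le> b" "c = c1 \<and> p = \<alpha> \<or> c = c2 \<and> p = \<beta>" "0 < W b" for a b c p
    using that \<alpha> \<beta> assms(4,5) nonneg
    by (intro powr_decay power_decr continuous_on_subset[OF cont]) auto
  have zero: "W (s + T2 + T1) = 0" if s: "0 < s" for s
  proof (rule ccontr)
    assume "W (s + T2 + T1) \<noteq> 0"
    hence pos1: "0 < W (s + T2 + T1)" using nonneg[of "s + T2 + T1"] s T by simp
    have "W (s + T2) \<ge> W (s + T2 + T1)"
    proof -
      have "0 \<le> integral {s + T2..s + T2 + T1} (\<lambda>s. c1 * W s powr \<alpha> + c2 * W s powr \<beta>)"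
        using s T \<alpha> \<beta> c
        by (intro Henstock_Kurzweil_Integration.integral_nonneg integrable_add int) auto
      thus ?thesis using decr[of "s + T2" "s + T2 + T1"] s T by simp
    qed
    with pos1 have pos2: "0 < W (s + T2)" by simp
    have "W (s + T2) powr (1 - \<beta>) / (1 - \<beta>) + c2 * T2 \<le> W s powr (1 - \<beta>) / (1 - \<beta>)"
      using decay[of s "s + T2" c2 \<beta>] s T pos2 by simp
    \<comment> \<open>This upper bound does not involve the value \<open>W s\<close>, and so the
      duration \<open>T2\<close> is independent of the initial state.\<close>
    also have "\<dots> \<le> 0" using \<beta> by (simp add: divide_nonneg_neg)
    also have "c2 * T2 = 1 / (\<beta> - 1)" using c by (simp add: T2_def)
    also have "W (s + T2) powr (1 - \<beta>) / (1 - \<beta>) = - (W (s + T2) powr (1 - \<beta>) / (\<beta> - 1))"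
      by (metis minus_diff_eq minus_divide_right)
    finally have "1 \<le> W (s + T2) powr (1 - \<beta>)"
      using \<beta> by (simp add: divide_le_cancel)
    hence le1: "W (s + T2) \<le> 1"
      using \<beta> pos2 by (metis less_eq_real_def linorder_not_le powr_less_one diff_less_0_iff_less)
    have "W (s + T2 + T1) powr (1 - \<alpha>) / (1 - \<alpha>) + c1 * T1 \<le> W (s + T2) powr (1 - \<alpha>) / (1 - \<alpha>)"
      using decay[of "s + T2" "s + T2 + T1" c1 \<alpha>] s T pos1 by simp
    also have "\<dots> \<le> 1 / (1 - \<alpha>)"
      using \<alpha> le1 pos2 by (intro divide_right_mono powr_le1) auto
    also have "c1 * T1 = 1 / (1 - \<alpha>)" using c by (simp add: T1_def)
    finally have "W (s + T2 + T1) powr (1 - \<alpha>) \<le> 0" using \<alpha> by (simp add: divide_le_0_iff)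
    with pos1 show False by simp
  qed
  have "isCont W (T1 + T2)"
    using cont T by (simp add: continuous_on_eq_continuous_at)
  moreover have "((\<lambda>s. s + T2 + T1) \<longlongrightarrow> T1 + T2) (at_right 0)"
    by (auto intro!: tendsto_eq_intros)
  ultimately have "((\<lambda>s. W (s + T2 + T1)) \<longlongrightarrow> W (T1 + T2)) (at_right 0)"
    by (rule isCont_tendsto_compose)
  moreover have "((\<lambda>s. W (s + T2 + T1)) \<longlongrightarrow> 0) (at_right 0)"
    using eventually_at_right_less[of "0 :: real"]
    by (intro tendsto_eventually) (auto elim!: eventually_mono simp: zero)
  ultimately show ?thesis
    unfolding T1_def[symmetric] T2_def[symmetric]
    using tendsto_unique[OF trivial_limit_at_right_real] by blast
qed

section \<open>Consensus from vanishing energy\<close>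

lemma consensus_of_energy_zero:
  fixes v :: "'n::finite \<Rightarrow> real \<Rightarrow> real"
  assumes L: "0 < L" and cont: "\<And>i. continuous_on {0..L} (v i)"
    and zero: "(\<Sum>i\<in>UNIV. integral {0..L} (\<lambda>x. (deviation (\<lambda>j. v j x) i)\<^sup>2)) = 0"
    and x: "x \<in> {0..L}"
  shows "v i x = v j x"
proof -
  have D: "continuous_on {0..L} (\<lambda>x. (deviation (\<lambda>j. v j x) i)\<^sup>2)" for i
    unfolding deviation_def by (intro continuous_intros cont) auto
  have "0 \<le> integral {0..L} (\<lambda>x. (deviation (\<lambda>j. v j x) i)\<^sup>2)" for i
    using D by (intro Henstock_Kurzweil_Integration.integral_nonneg integrable_continuous_interval) auto
  hence "integral {0..L} (\<lambda>x. (deviation (\<lambda>j. v j x) i)\<^sup>2) = 0" for i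
    using zero by (simp add: sum_nonneg_eq_0_iff)
  \<comment> \<open>A continuous nonnegative function with integral 0 vanishes at every point, hence
    agreement at each \<open>x\<close> and not just almost everywhere.\<close>
  hence "(deviation (\<lambda>j. v j x) i)\<^sup>2 = 0" for i
    using integral_eq_0_iff[OF D L] x by auto
  thus ?thesis using deviation_diff[of "\<lambda>j. v j x" i j] by simp
qed

lemma terminal_time_of_consensus:
  fixes y :: "'n \<Rightarrow> real \<Rightarrow> real \<Rightarrow> real"
  assumes ts: "0 < ts" and cont: "\<And>i. continuous_on ({0..L} \<times> {0<..}) (\<lambda>(x, t). y i x t)"
    and eq: "\<And>x i j. x \<in> {0..L} \<Longrightarrow> y i x ts = y j x ts"
  shows "terminal_time L y ts"
  unfolding terminal_time_def
proof (intro conjI ballI allI)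
  fix x i j assume x: "x \<in> {0..L}"
  have "continuous_on {0<..} (y i x)" for i
    by (rule continuous_on_compose2[OF cont[of i], of _ "\<lambda>t. (x, t)", simplified])
       (use x in \<open>auto intro!: continuous_intros\<close>)
  hence "(y i x \<longlongrightarrow> y i x ts) (at ts)" for i
    using ts by (simp add: continuous_on_eq_continuous_at isCont_def)
  hence "((\<lambda>t. \<bar>y i x t - y j x t\<bar>) \<longlongrightarrow> \<bar>y i x ts - y j x ts\<bar>) (at ts)"
    by (intro tendsto_intros)
  hence "((\<lambda>t. \<bar>y i x t - y j x t\<bar>) \<longlongrightarrow> 0) (at ts)"
    using eq[OF x, of i j] by simp
  thus "((\<lambda>t. \<bar>y i x t - y j x t\<bar>) \<longlongrightarrow> 0) (at ts within {0..})"
    by (rule tendsto_within_subset) simp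
qed (use ts in simp)

theorem theorem3p2:
  fixes A :: "real ^ 'n ^ 'n"
    and d :: "'n \<Rightarrow> real \<Rightarrow> real \<Rightarrow> real"
    and \<alpha> \<beta> L k dbar dmax :: real
  assumes "0 < \<alpha>" "\<alpha> < 1" "\<beta> > 1" "L > 0" "k > 0" "dbar > 0"
    and "adjacency_matrix A" "undirected A" "connected_graph A"
    and "\<And>i. continuous_on ({0..L} \<times> {0..}) (\<lambda>(x, t). d i x t)"
    and "\<And>i x t. x \<in> {0..L} \<Longrightarrow> t \<ge> 0 \<Longrightarrow> \<bar>d i x t\<bar> \<le> dmax"
  defines "N \<equiv> real CARD('n)"
    and "E \<equiv> (\<chi> i j. (A $ i $ j)\<^sup>2) :: real ^ 'n ^ 'n"
    and "B \<equiv> (\<chi> i j. (A $ i $ j) powr (1 / \<alpha>)) :: real ^ 'n ^ 'n"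
    and "P \<equiv> (\<chi> i j. (A $ i $ j) powr (1 / \<beta>)) :: real ^ 'n ^ 'n"
  defines "C1 \<equiv> (2 * lambda2 (laplacian B)) powr \<alpha>"
    and "C2 \<equiv> (2 * lambda2 (laplacian P)) powr \<beta>"
  defines "Tmax \<equiv> 1 / (C1 * (1 - \<alpha>)) + 1 / ((N powr (1 - \<beta>))\<^sup>2 * C2 * (\<beta> - 1))"
  assumes "dbar \<ge> 2 * dmax * N powr (1 / 2) / (sqrt 2 * lambda2 (laplacian E) powr (1 / 2))"
  shows "fixed_time_consensus L (closed_loop_trajectories A L k \<alpha> \<beta> dbar d) \<and>
    (\<forall>y\<in>closed_loop_trajectories A L k \<alpha> \<beta> dbar d. \<exists>ts. terminal_time L y ts \<and> ts \<le> Tmax)"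
proof -
  have "\<exists>ts. terminal_time L y ts \<and> ts \<le> Tmax"
    if y: "y \<in> closed_loop_trajectories A L k \<alpha> \<beta> dbar d" for y
  proof (cases "CARD('n) \<ge> 2")
    \<comment> \<open>For a single agent \<open>lambda2\<close> is the \<open>Inf\<close> of the
      empty set and carries no information. Consensus holds at time 0, and \<open>Tmax\<close> is
      nonnegative whatever that value is.\<close>
    case False
    hence "i = j" for i j :: 'n
      using card_le_Suc0_iff_eq[of "UNIV :: 'n set"] by auto
    hence "(\<lambda>t. \<bar>y i x t - y j x t\<bar>) = (\<lambda>t. 0)" for i j x
      by (metis abs_zero diff_self)
    hence "terminal_time L y 0" unfolding terminal_time_def by simp
    moreover have "0 \<le> Tmax"
      using assms(2,3) by (simp add: Tmax_def C1_def C2_def)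
    ultimately show ?thesis by blast
  next
    case True
    have graph: "adjacency_matrix M \<and> undirected M \<and> connected_graph M" if "M \<in> {E, B, P}" for M
    proof (intro conjI)
      show "adjacency_matrix M" "undirected M"
        using that assms(8) by (auto simp: E_def B_def P_def adjacency_matrix_def undirected_def)
      show "connected_graph M"
        by (rule connected_graph_mono[OF assms(9)]) (use that in \<open>auto simp: E_def B_def P_def\<close>)
    qed
    have lam: "0 < lambda2 (laplacian E)" "0 < lambda2 (laplacian B)" "0 < lambda2 (laplacian P)"
      using graph True by (auto intro!: lambda2_laplacian_pos)
    obtain y0 yt yxx where sd: "\<And>i. strong_derivatives L (y i) (yt i) (yxx i)"
      and pde: "AE (x, t) in lborel. x \<in> {0..L} \<and> t > 0 \<longrightarrow>
           (\<exists>\<sigma>. admissible_signs (\<lambda>i. y i x t) \<sigma> \<and>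
                (\<forall>i. yt i x t = k * yxx i x t + control A L \<alpha> \<beta> dbar y \<sigma> i x t + d i x t))"
      and bc: "\<And>i t. t > 0 \<Longrightarrow> y i 0 t = 0" "\<And>i t. t > 0 \<Longrightarrow> y i L t = 0"
      using y unfolding closed_loop_trajectories_def closed_loop_solution_def by blast
    have cont: "continuous_on ({0..L} \<times> {0<..}) (\<lambda>(x, t). y i x t)" for i
      using sd by (simp add: strong_derivatives_def)
    define W where "W t = (\<Sum>i\<in>UNIV. integral {0..L} (\<lambda>x. (deviation (\<lambda>j. y j x t) i)\<^sup>2))" for t
    have C: "0 < C1" "0 < (N powr (1 - \<beta>))\<^sup>2 * C2"
      using lam by (simp_all add: C1_def C2_def N_def)
    have "W Tmax = 0"
      unfolding Tmax_def
    proof (rule fixed_settling_time[OF assms(1-3) C])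
      show "continuous_on {0<..} W"
        unfolding W_def by (rule consensus_energy_continuous[OF cont])
      show "0 \<le> W t" for t
        unfolding W_def by (rule consensus_energy_nonneg)
      show "W b - W a \<le> - integral {a..b} (\<lambda>s. C1 * W s powr \<alpha> + (N powr (1 - \<beta>))\<^sup>2 * C2 * W s powr \<beta>)"
        if "0 < a" "a \<le> b" for a b
        unfolding W_def C1_def C2_def N_def B_def P_def
        by (rule closed_loop_energy_decay[OF assms(1-5) assms(7,8,11) lam(1)[unfolded E_def]
              less_imp_le[OF lam(2)[unfolded B_def]] less_imp_le[OF lam(3)[unfolded P_def]]
              assms(19)[unfolded N_def E_def] sd pde bc that])
    qed
    moreover have Tmax: "0 < Tmax" using C assms(2,3) by (simp add: Tmax_def add_pos_pos)
    moreover have "continuous_on {0..L} (\<lambda>x. y i x Tmax)" for i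
      by (rule continuous_on_compose2[OF cont[of i], of _ "\<lambda>x. (x, Tmax)", simplified])
         (use Tmax in \<open>auto intro!: continuous_intros\<close>)
    ultimately have "y i x Tmax = y j x Tmax" if "x \<in> {0..L}" for x i j
      using consensus_of_energy_zero[OF assms(4), of "\<lambda>i x. y i x Tmax"] that by (simp add: W_def)
    hence "terminal_time L y Tmax" by (rule terminal_time_of_consensus[OF Tmax cont])
    thus ?thesis by blast
  qed
  \<comment> \<open>Fixed-time consensus asks for a positive bound, while with a single agent
    \<open>Tmax\<close> is only shown to be nonnegative.\<close>
  moreover have "Tmax \<le> max 1 Tmax" "0 < max 1 Tmax" by auto
  ultimately show ?thesis
    unfolding fixed_time_consensus_def finite_time_consensus_def by (meson order_trans)
qed

end
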